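(* Let $A$ be a countable subset of the Urysohn sphere $\mathfrak{U}$, let $n\geq 1$, and let $f:\mathfrak{U}^n\to\mathfrak{U}$ be an $A$-definable function with natural extension $\tilde{f}:\mathbb{U}^n\to\mathbb{U}$. Then either: (1) $\tilde{f}(\mathbb{U}^n)$ is a compact subset of $\bar{A}$ (the closure of $A$), or (2) $\tilde{f}=\pi_i$ for some $i\in\{1,\ldots,n\}$, where $\pi_i:\mathbb{U}^n\to\mathbb{U}$ is the projection onto the $i$-th coordinate.
   Context: The Urysohn sphere $\mathfrak{U}$ is the unique (up to isometry) complete separable metric space of diameter $1$ which is universal (every Polish metric space of diameter at most $1$ isometrically embeds into it) and ultrahomogeneous (every isometry between finite subsets extends to an isometry of $\mathfrak{U}$). It is viewed as a metric structure in continuous logic in the empty bounded metric signature (only the metric symbol $d$, with $d\leq 1$). $\mathbb{U}$ denotes an $\omega_1$-saturated ($\omega_1$-universal domain) elementary extension of $\mathfrak{U}$ for $\operatorname{Th}(\mathfrak{U})$. Products $\mathbb{U}^n$ carry the maximum metric. A function $f:\mathfrak{U}^n\to\mathfrak{U}$ is $A$-definable if there are continuous formulas $\varphi_k(x,y)$ with parameters from $A$ whose interpretations in $\mathfrak{U}$ converge uniformly to $d(f(x),y)$; the interpretations in $\mathbb{U}$ then converge uniformly to a predicate whose zeroset is the graph of a function $\tilde{f}:\mathbb{U}^n\to\mathbb{U}$, the natural extension of $f$. *)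

theory Defs
  imports "HOL-Analysis.Analysis"
begin

section \<open>Metric structures in the empty bounded metric signature\<close>

text \<open>A structure is a nonempty complete metric space with distances in \<open>[0,1]\<close>.\<close>

definition metric_structure :: "'a metric \<Rightarrow> bool" where
  "metric_structure M \<longleftrightarrow>
     mspace M \<noteq> {} \<and> mcomplete_of M \<and> (\<forall>x\<in>mspace M. \<forall>y\<in>mspace M. mdist M x y \<le> 1)"

definition isometric_on :: "'a set \<Rightarrow> 'a metric \<Rightarrow> 'b metric \<Rightarrow> ('a \<Rightarrow> 'b) \<Rightarrow> bool" where
  "isometric_on S M N h \<longleftrightarrow>
     h \<in> S \<rightarrow> mspace N \<and> (\<forall>x\<in>S. \<forall>y\<in>S. mdist N (h x) (h y) = mdist M x y)"

text \<open>A Polish space has at most continuum many points, so up to isometry it lives on a set of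
  reals; the quantification over \<^typ>\<open>real metric\<close> therefore covers all Polish metric spaces.\<close>

definition urysohn_universal :: "'a metric \<Rightarrow> bool" where
  "urysohn_universal M \<longleftrightarrow>
     (\<forall>P :: real metric.
        mcomplete_of P \<and> separable_space (mtopology_of P) \<and>
        (\<forall>x\<in>mspace P. \<forall>y\<in>mspace P. mdist P x y \<le> 1)
        \<longrightarrow> (\<exists>h. isometric_on (mspace P) P M h))"

definition ultrahomogeneous :: "'a metric \<Rightarrow> bool" where
  "ultrahomogeneous M \<longleftrightarrow>
     (\<forall>S T h. finite S \<and> finite T \<and> S \<subseteq> mspace M \<and> T \<subseteq> mspace M \<and>
        isometric_on S M M h \<and> h ` S = T
        \<longrightarrow> (\<exists>g. isometric_on (mspace M) M M g \<and> g ` mspace M = mspace M \<and> (\<forall>x\<in>S. g x = h x)))"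

definition urysohn_sphere :: "'a metric \<Rightarrow> bool" where
  "urysohn_sphere M \<longleftrightarrow>
     metric_structure M \<and> separable_space (mtopology_of M) \<and>
     (SUP (x, y)\<in>mspace M \<times> mspace M. mdist M x y) = 1 \<and>
     urysohn_universal M \<and> ultrahomogeneous M"

section \<open>Continuous formulas\<close>

text \<open>Parameters are elements of the structure, used as constant symbols naming themselves.
  A connective is a function \<open>[0,1]\<^sup>n \<rightarrow> [0,1]\<close> applied to a list of \<open>n\<close> formulas; its
  continuity is imposed by \<open>wf_form\<close> below.\<close>

datatype 'a trm = Var nat | Param 'a

datatype 'a form =
    Dist "'a trm" "'a trm"
  | Conn "(nat \<Rightarrow> real) \<Rightarrow> real" "'a form list"
  | SupF nat "'a form"
  | InfF nat "'a form"

fun wf_form :: "'a form \<Rightarrow> bool" where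
  "wf_form (Dist s t) \<longleftrightarrow> True"
| "wf_form (Conn u fs) \<longleftrightarrow>
     continuous_map (product_topology (\<lambda>_. top_of_set {0..1}) {..<length fs}) (top_of_set {0..1}) u
     \<and> (\<forall>\<phi>\<in>set fs. wf_form \<phi>)"
| "wf_form (SupF v \<phi>) \<longleftrightarrow> wf_form \<phi>"
| "wf_form (InfF v \<phi>) \<longleftrightarrow> wf_form \<phi>"

fun trm_vars :: "'a trm \<Rightarrow> nat set" where
  "trm_vars (Var v) = {v}"
| "trm_vars (Param a) = {}"

fun trm_params :: "'a trm \<Rightarrow> 'a set" where
  "trm_params (Var v) = {}"
| "trm_params (Param a) = {a}"

fun free_vars :: "'a form \<Rightarrow> nat set" where
  "free_vars (Dist s t) = trm_vars s \<union> trm_vars t"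
| "free_vars (Conn u fs) = (\<Union>\<phi>\<in>set fs. free_vars \<phi>)"
| "free_vars (SupF v \<phi>) = free_vars \<phi> - {v}"
| "free_vars (InfF v \<phi>) = free_vars \<phi> - {v}"

fun params :: "'a form \<Rightarrow> 'a set" where
  "params (Dist s t) = trm_params s \<union> trm_params t"
| "params (Conn u fs) = (\<Union>\<phi>\<in>set fs. params \<phi>)"
| "params (SupF v \<phi>) = params \<phi>"
| "params (InfF v \<phi>) = params \<phi>"

text \<open>Formulas over the parameter set \<open>A\<close> with free variables among those indexed by \<open>V\<close>.\<close>

definition formulas :: "'a set \<Rightarrow> nat set \<Rightarrow> 'a form set" where
  "formulas A V = {\<phi>. wf_form \<phi> \<and> params \<phi> \<subseteq> A \<and> free_vars \<phi> \<subseteq> V}"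

fun trm_val :: "'a trm \<Rightarrow> (nat \<Rightarrow> 'a) \<Rightarrow> 'a" where
  "trm_val (Var v) e = e v"
| "trm_val (Param a) e = a"

fun val :: "'a metric \<Rightarrow> 'a form \<Rightarrow> (nat \<Rightarrow> 'a) \<Rightarrow> real" where
  "val M (Dist s t) e = mdist M (trm_val s e) (trm_val t e)"
| "val M (Conn u fs) e = u (\<lambda>i\<in>{..<length fs}. map (\<lambda>\<phi>. val M \<phi> e) fs ! i)"
| "val M (SupF v \<phi>) e = (SUP a\<in>mspace M. val M \<phi> (e(v := a)))"
| "val M (InfF v \<phi>) e = (INF a\<in>mspace M. val M \<phi> (e(v := a)))"

section \<open>Elementary extensions and saturation\<close>

text \<open>\<open>tuples n M\<close> is the set of \<open>n\<close>-tuples, with coordinates indexed by \<open>0, \<dots>, n - 1\<close>.\<close>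

abbreviation tuples :: "nat \<Rightarrow> 'a metric \<Rightarrow> (nat \<Rightarrow> 'a) set" where
  "tuples n M \<equiv> {..<n} \<rightarrow>\<^sub>E mspace M"

definition elementary_extension :: "'a metric \<Rightarrow> 'a metric \<Rightarrow> bool" where
  "elementary_extension M N \<longleftrightarrow>
     mspace M \<subseteq> mspace N \<and>
     (\<forall>x\<in>mspace M. \<forall>y\<in>mspace M. mdist M x y = mdist N x y) \<and>
     (\<forall>n. \<forall>\<phi>\<in>formulas {} {..<n}. \<forall>e\<in>tuples n M. val M \<phi> e = val N \<phi> e)"

text \<open>A formula \<open>\<phi>\<close> stands for the condition \<open>\<phi> = 0\<close>.\<close>

definition omega1_saturated :: "'a metric \<Rightarrow> bool" where
  "omega1_saturated N \<longleftrightarrow>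
     (\<forall>B n \<Gamma>. countable B \<and> B \<subseteq> mspace N \<and> \<Gamma> \<subseteq> formulas B {..<n} \<and>
        (\<forall>\<Delta>\<subseteq>\<Gamma>. finite \<Delta> \<longrightarrow> (\<exists>e\<in>tuples n N. \<forall>\<phi>\<in>\<Delta>. val N \<phi> e = 0))
        \<longrightarrow> (\<exists>e\<in>tuples n N. \<forall>\<phi>\<in>\<Gamma>. val N \<phi> e = 0))"

section \<open>Definable functions and their natural extensions\<close>

text \<open>In \<open>\<phi>\<^sub>k(x,y)\<close> the tuple \<open>x\<close> is assigned to the variables \<open>0, \<dots>, n - 1\<close> and \<open>y\<close> to the
  variable \<open>n\<close>.\<close>

definition defines_function ::
  "'a metric \<Rightarrow> 'a set \<Rightarrow> nat \<Rightarrow> (nat \<Rightarrow> 'a form) \<Rightarrow> ((nat \<Rightarrow> 'a) \<Rightarrow> 'a) \<Rightarrow> bool" where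
  "defines_function M A n \<phi> f \<longleftrightarrow>
     f \<in> tuples n M \<rightarrow> mspace M \<and>
     (\<forall>k. \<phi> k \<in> formulas A {..n}) \<and>
     uniform_limit (tuples n M \<times> mspace M)
       (\<lambda>k (x, y). val M (\<phi> k) (x(n := y))) (\<lambda>(x, y). mdist M (f x) y) sequentially"

definition definable_function ::
  "'a metric \<Rightarrow> 'a set \<Rightarrow> nat \<Rightarrow> ((nat \<Rightarrow> 'a) \<Rightarrow> 'a) \<Rightarrow> bool" where
  "definable_function M A n f \<longleftrightarrow> (\<exists>\<phi>. defines_function M A n \<phi> f)"

definition natural_extension ::
  "'a metric \<Rightarrow> 'a metric \<Rightarrow> 'a set \<Rightarrow> nat \<Rightarrow> ((nat \<Rightarrow> 'a) \<Rightarrow> 'a) \<Rightarrow> ((nat \<Rightarrow> 'a) \<Rightarrow> 'a) \<Rightarrow> bool" where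
  "natural_extension M N A n f g \<longleftrightarrow>
     g \<in> tuples n N \<rightarrow> mspace N \<and>
     (\<exists>\<phi> P. defines_function M A n \<phi> f \<and>
        uniform_limit (tuples n N \<times> mspace N)
          (\<lambda>k (x, y). val N (\<phi> k) (x(n := y))) P sequentially \<and>
        (\<forall>x\<in>tuples n N. \<forall>y\<in>mspace N. P (x, y) = 0 \<longleftrightarrow> y = g x))"

end

theory Submission
  imports Defs
begin

text \<open>Saturation turns the finite extension property of the Urysohn sphere into the exact one-point
  extension property over countable sets in \<open>V\<close>, and a back-and-forth argument shows that formulas
  only depend on the distances of their arguments to each other and to the parameters. Hence the
  graph of \<open>g\<close> is invariant under isometries over \<open>A\<close>, which forces every value \<open>g x\<close> to lie in the
  closure of \<open>A\<close> or among the coordinates of \<open>x\<close>. On tuples whose coordinates are distinct and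
  away from \<open>A\<close> these alternatives exclude each other, so by connectedness and continuity only one
  of them occurs, and such tuples are dense. If all values are in the closure of \<open>A\<close>, a sequence of
  values whose distances to the points of \<open>A\<close> converge has, by saturation, a limit that is again a
  value; hence the range is compact.\<close>

section \<open>Formulas and saturation\<close>

text \<open>The finite extension property cannot pass from \<open>U\<close> to \<open>V\<close> as
  it stands: it promises a point provided that the prescribed distances satisfy the Katetov
  inequalities, and such an implication is not a continuous formula. It is replaced by an estimate
  valid for all points, in which the violation of those inequalities (\<open>defect\<close>) is
  subtracted as an error term; this estimate is a sentence. In \<open>V\<close> it yields
  approximate witnesses, which saturation makes exact. A second obstacle is that \<open>g\<close> is
  known only through its graph, the zero set of a limit of formulas. Its continuity has to be
  derived, from the stability of the graph under limits of distance patterns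
  (\<open>graph_limit\<close>) and under isometries over \<open>A\<close>
  (\<open>graph_invariant\<close>). Connectedness takes the concrete form of bisection:
  \<open>V\<close> has midpoints whose distances to a given countable set are averages, so lower
  bounds on distances persist.\<close>

lemma val_bounds:
  assumes "metric_structure M" "wf_form \<phi>" "params \<phi> \<subseteq> mspace M"
    and "\<And>v. v \<in> free_vars \<phi> \<Longrightarrow> e v \<in> mspace M"
  shows "0 \<le> val M \<phi> e \<and> val M \<phi> e \<le> 1"
  using assms(2-)
proof (induction \<phi> arbitrary: e)
  case (Dist s t)
  have "trm_val s e \<in> mspace M" "trm_val t e \<in> mspace M"
    using Dist.prems by (cases s; cases t; force)+
  then show ?case
    using assms(1) by (auto simp: metric_structure_def)
next
  case (Conn u fs)
  let ?h = "\<lambda>i\<in>{..<length fs}. map (\<lambda>\<phi>. val M \<phi> e) fs ! i"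
  have "0 \<le> val M (fs ! i) e \<and> val M (fs ! i) e \<le> 1" if "i < length fs" for i
  proof (rule Conn.IH)
    show mem: "fs ! i \<in> set fs" using that by simp
    show "wf_form (fs ! i)" "params (fs ! i) \<subseteq> mspace M" using Conn.prems(1,2) mem by auto
    show "e v \<in> mspace M" if "v \<in> free_vars (fs ! i)" for v
      using Conn.prems(3)[of v] mem that by auto
  qed
  then have "?h \<in> topspace (product_topology (\<lambda>_. top_of_set {0..1}) {..<length fs})"
    by auto
  moreover have "continuous_map (product_topology (\<lambda>_. top_of_set {0..1}) {..<length fs})
      (top_of_set {0..1}) u"
    using Conn.prems by simp
  ultimately have "u ?h \<in> topspace (top_of_set {0..1})"
    unfolding continuous_map_def by blast
  then show ?case by simp
next
  case (SupF v \<phi>)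
  have *: "0 \<le> val M \<phi> (e(v := a)) \<and> val M \<phi> (e(v := a)) \<le> 1" if "a \<in> mspace M" for a
    using SupF.prems that by (intro SupF.IH) auto
  obtain a where a: "a \<in> mspace M" using assms(1) by (auto simp: metric_structure_def)
  have "0 \<le> (SUP a\<in>mspace M. val M \<phi> (e(v := a)))"
    using * a by (intro cSUP_upper2[OF _ a]) (auto intro!: bdd_aboveI)
  moreover have "(SUP a\<in>mspace M. val M \<phi> (e(v := a))) \<le> 1"
    using * a by (intro cSUP_least) auto
  ultimately show ?case by simp
next
  case (InfF v \<phi>)
  have *: "0 \<le> val M \<phi> (e(v := a)) \<and> val M \<phi> (e(v := a)) \<le> 1" if "a \<in> mspace M" for a
    using InfF.prems that by (intro InfF.IH) auto
  obtain a where a: "a \<in> mspace M" using assms(1) by (auto simp: metric_structure_def)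
  have "(INF a\<in>mspace M. val M \<phi> (e(v := a))) \<le> 1"
    using * a by (intro cINF_lower2[OF _ a]) (auto intro!: bdd_belowI)
  moreover have "0 \<le> (INF a\<in>mspace M. val M \<phi> (e(v := a)))"
    using * a by (intro cINF_greatest) auto
  ultimately show ?case by simp
qed

definition neg_form :: "'a form \<Rightarrow> 'a form" where
  "neg_form \<phi> = Conn (\<lambda>h. 1 - h 0) [\<phi>]"

text \<open>A condition is the vanishing of a formula. Truncated subtraction puts an upper bound
  \<open>r\<close> into this form, and lower bounds become upper bounds through
  \<open>neg_form\<close>.\<close>

definition excess_form :: "real \<Rightarrow> 'a form \<Rightarrow> 'a form" where
  "excess_form r \<phi> = Conn (\<lambda>h. max 0 (h 0 - r)) [\<phi>]"

lemma continuous_map_coordinate: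
  assumes "i \<in> I"
  shows "continuous_map (product_topology (\<lambda>_. top_of_set {0..1::real}) I) euclideanreal (\<lambda>h. h i)"
  using continuous_map_product_projection[OF assms, of "\<lambda>_. top_of_set {0..1::real}"]
  by (simp add: continuous_map_in_subtopology)

lemma neg_form [simp]:
  "val M (neg_form \<phi>) e = 1 - val M \<phi> e"
  "neg_form \<phi> \<in> formulas B W \<longleftrightarrow> \<phi> \<in> formulas B W"
proof -
  have "continuous_map (product_topology (\<lambda>_. top_of_set {0..1}) {..<Suc 0}) (top_of_set {0..1})
      (\<lambda>h. 1 - h 0 :: real)"
    unfolding continuous_map_in_subtopology
    by (intro conjI continuous_intros continuous_map_coordinate) (auto simp: PiE_iff)
  then show "neg_form \<phi> \<in> formulas B W \<longleftrightarrow> \<phi> \<in> formulas B W"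
    by (auto simp: neg_form_def formulas_def)
qed (simp add: neg_form_def)

lemma excess_form [simp]:
  "val M (excess_form r \<phi>) e = 0 \<longleftrightarrow> val M \<phi> e \<le> r"
  "r \<ge> 0 \<Longrightarrow> excess_form r \<phi> \<in> formulas B W \<longleftrightarrow> \<phi> \<in> formulas B W"
proof -
  assume "r \<ge> 0"
  then have "continuous_map (product_topology (\<lambda>_. top_of_set {0..1}) {..<Suc 0}) (top_of_set {0..1})
      (\<lambda>h. max 0 (h 0 - r) :: real)"
    unfolding continuous_map_in_subtopology
  proof (intro conjI)
    show "continuous_map (product_topology (\<lambda>_. top_of_set {0..1}) {..<Suc 0}) euclideanreal
        (\<lambda>h. max 0 (h 0 - r))"
      by (intro continuous_map_real_max continuous_map_diff continuous_map_coordinate) auto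
    have "max 0 (h 0 - r) \<in> {0..1}" if "h 0 \<in> {0..1}" for h :: "nat \<Rightarrow> real"
      using that \<open>r \<ge> 0\<close> by auto
    then show "(\<lambda>h. max 0 (h 0 - r)) \<in> topspace
        (product_topology (\<lambda>_. top_of_set {0..1}) {..<Suc 0}) \<rightarrow> {0..1}"
      by (simp add: PiE_iff Pi_iff)
  qed
  then show "excess_form r \<phi> \<in> formulas B W \<longleftrightarrow> \<phi> \<in> formulas B W"
    by (auto simp: excess_form_def formulas_def)
qed (auto simp: excess_form_def max_def)

text \<open>This plays the role of an ultralimit: the sequence itself need not converge, yet bounds
  that hold in the limit along it are attained exactly by one tuple.\<close>

lemma saturated_limit:
  assumes "omega1_saturated M" "countable B" "B \<subseteq> mspace M"
    and form: "\<And>\<phi> r. (\<phi>, r) \<in> \<Gamma> \<Longrightarrow> \<phi> \<in> formulas B {..<N} \<and> r \<ge> 0"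
    and e: "\<And>m. e m \<in> tuples N M"
    and ev: "\<And>\<phi> r \<epsilon>. (\<phi>, r) \<in> \<Gamma> \<Longrightarrow> \<epsilon> > 0 \<Longrightarrow> \<forall>\<^sub>F m in sequentially. val M \<phi> (e m) \<le> r + \<epsilon>"
  shows "\<exists>e'\<in>tuples N M. \<forall>(\<phi>, r)\<in>\<Gamma>. val M \<phi> e' \<le> r"
proof -
  \<comment> \<open>Each bound is relaxed by every positive amount. Finitely many relaxed bounds
    hold together at a late member of the sequence, and all of them together force the sharp
    bounds.\<close>
  define \<Gamma>' where "\<Gamma>' = {excess_form (r + \<epsilon>) \<phi> | \<phi> r \<epsilon>. (\<phi>, r) \<in> \<Gamma> \<and> \<epsilon> > 0}"
  have "\<Gamma>' \<subseteq> formulas B {..<N}"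
    using form by (force simp: \<Gamma>'_def)
  moreover have "\<exists>e'\<in>tuples N M. \<forall>\<phi>\<in>\<Delta>. val M \<phi> e' = 0" if "\<Delta> \<subseteq> \<Gamma>'" "finite \<Delta>" for \<Delta>
  proof -
    have "\<forall>\<^sub>F m in sequentially. \<forall>\<phi>\<in>\<Delta>. val M \<phi> (e m) = 0"
      using that ev by (intro eventually_ball_finite) (auto simp: \<Gamma>'_def)
    then show ?thesis
      using e eventually_happens[of _ sequentially] by fastforce
  qed
  ultimately obtain e' where e': "e' \<in> tuples N M" "\<And>\<phi>. \<phi> \<in> \<Gamma>' \<Longrightarrow> val M \<phi> e' = 0"
    using assms(1-3) unfolding omega1_saturated_def by metis
  have "val M \<phi> e' \<le> r" if "(\<phi>, r) \<in> \<Gamma>" for \<phi> r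
  proof (rule field_le_epsilon)
    fix \<epsilon> :: real assume "\<epsilon> > 0"
    then have "excess_form (r + \<epsilon>) \<phi> \<in> \<Gamma>'" using that by (auto simp: \<Gamma>'_def)
    then show "val M \<phi> e' \<le> r + \<epsilon>" using e'(2) by fastforce
  qed
  then show ?thesis using e'(1) by blast
qed

text \<open>Parameters and variables are treated alike, so that a partial isometry fixing
  \<open>B\<close> pointwise becomes one condition on pairs of terms.\<close>

definition terms :: "'a set \<Rightarrow> nat set \<Rightarrow> 'a trm set" where
  "terms B W = Param ` B \<union> Var ` W"

lemma Dist_formulas: "s \<in> terms B W \<Longrightarrow> t \<in> terms B W \<Longrightarrow> Dist s t \<in> formulas B W"
  by (auto simp: terms_def formulas_def)

lemma terms_val:
  "s \<in> terms B W \<Longrightarrow> B \<subseteq> mspace M \<Longrightarrow> (\<And>v. v \<in> W \<Longrightarrow> e v \<in> mspace M) \<Longrightarrow> trm_val s e \<in> mspace M"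
  by (auto simp: terms_def)

text \<open>A limit \<open>L s t\<close> is pinned down by two upper bounds, one on the distance and
  one on its negation. \<open>T\<close> selects the distances whose limits are to be
  realised.\<close>

lemma saturated_limit_dist:
  assumes M: "metric_structure M" and "omega1_saturated M" "countable B" "B \<subseteq> mspace M"
    and form: "\<And>\<phi> r. (\<phi>, r) \<in> \<Gamma> \<Longrightarrow> \<phi> \<in> formulas B {..<N} \<and> r \<ge> 0"
    and e: "\<And>m. e m \<in> tuples N M"
    and ev: "\<And>\<phi> r m. (\<phi>, r) \<in> \<Gamma> \<Longrightarrow> val M \<phi> (e m) \<le> r"
    and T: "T \<subseteq> terms B {..<N} \<times> terms B {..<N}"
    and lim: "\<And>s t. (s, t) \<in> T \<Longrightarrow> (\<lambda>m. mdist M (trm_val s (e m)) (trm_val t (e m))) \<longlonglongrightarrow> L s t"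
  shows "\<exists>e'\<in>tuples N M. (\<forall>(\<phi>, r)\<in>\<Gamma>. val M \<phi> e' \<le> r)
      \<and> (\<forall>(s, t)\<in>T. mdist M (trm_val s e') (trm_val t e') = L s t)"
proof -
  define \<Delta> where "\<Delta> = \<Gamma> \<union> (\<lambda>(s, t). (Dist s t, L s t)) ` T
      \<union> (\<lambda>(s, t). (neg_form (Dist s t), 1 - L s t)) ` T"
  have le1: "mdist M (trm_val s (e m)) (trm_val t (e m)) \<le> 1" if "(s, t) \<in> T" for s t m
    using val_bounds[OF M, of "Dist s t" "e m"] T that e[of m] assms(4)
    by (fastforce simp: terms_def)
  \<comment> \<open>The bounds fed to \<open>saturated_limit\<close>, here \<open>L s t\<close> and
    \<open>1 - L s t\<close>, must be nonnegative.\<close>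
  have L: "0 \<le> L s t" "L s t \<le> 1" if "(s, t) \<in> T" for s t
    using LIMSEQ_le_const[OF lim[OF that], of 0] LIMSEQ_le_const2[OF lim[OF that], of 1] le1[OF that]
    by auto
  have "\<exists>e'\<in>tuples N M. \<forall>(\<phi>, r)\<in>\<Delta>. val M \<phi> e' \<le> r"
  proof (rule saturated_limit[OF assms(2-4) _ e])
    fix \<phi> r assume "(\<phi>, r) \<in> \<Delta>"
    then show "\<phi> \<in> formulas B {..<N} \<and> r \<ge> 0"
      using form L T Dist_formulas by (fastforce simp: \<Delta>_def)
  next
    fix \<phi> and r \<epsilon> :: real assume r: "(\<phi>, r) \<in> \<Delta>" and \<epsilon>: "\<epsilon> > 0"
    have *: "\<forall>\<^sub>F m in sequentially. \<bar>mdist M (trm_val s (e m)) (trm_val t (e m)) - L s t\<bar> < \<epsilon>"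
      if "(s, t) \<in> T" for s t
      using tendstoD[OF lim[OF that] \<epsilon>] by (simp add: dist_real_def)
    from r consider "(\<phi>, r) \<in> \<Gamma>" | s t where "(s, t) \<in> T" "\<phi> = Dist s t" "r = L s t"
      | s t where "(s, t) \<in> T" "\<phi> = neg_form (Dist s t)" "r = 1 - L s t"
      by (auto simp: \<Delta>_def)
    then show "\<forall>\<^sub>F m in sequentially. val M \<phi> (e m) \<le> r + \<epsilon>"
    proof cases
      case 1
      then show ?thesis using ev \<epsilon> by (intro always_eventually allI) (smt (verit))
    next
      case 2
      show ?thesis using *[OF 2(1)] by eventually_elim (auto simp: 2)
    next
      case 3
      show ?thesis using *[OF 3(1)] by eventually_elim (auto simp: 3)
    qed
  qed
  then obtain e' where e': "e' \<in> tuples N M" "\<And>\<phi> r. (\<phi>, r) \<in> \<Delta> \<Longrightarrow> val M \<phi> e' \<le> r" by blast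
  have "mdist M (trm_val s e') (trm_val t e') = L s t" if "(s, t) \<in> T" for s t
  proof -
    have "(Dist s t, L s t) \<in> \<Delta>" "(neg_form (Dist s t), 1 - L s t) \<in> \<Delta>"
      using that by (auto simp: \<Delta>_def)
    then show ?thesis using e'(2)[of "Dist s t" "L s t"] e'(2)[of "neg_form (Dist s t)" "1 - L s t"]
      by simp
  qed
  then show ?thesis using e' by (auto simp: \<Delta>_def intro!: bexI[of _ e'])
qed

section \<open>One-point extensions\<close>

text \<open>Katetov functions: the possible distances from a new point to given ones, in spaces of
  diameter at most 1. Indexing by a family permits repeated points, on which the inequalities force
  equal values.\<close>

definition katetov :: "'a metric \<Rightarrow> 'i set \<Rightarrow> ('i \<Rightarrow> 'a) \<Rightarrow> ('i \<Rightarrow> real) \<Rightarrow> bool" where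
  "katetov M I p k \<longleftrightarrow>
     (\<forall>i\<in>I. 0 \<le> k i \<and> k i \<le> 1) \<and>
     (\<forall>i\<in>I. \<forall>j\<in>I. \<bar>k i - k j\<bar> \<le> mdist M (p i) (p j) \<and> mdist M (p i) (p j) \<le> k i + k j)"

lemma katetovD:
  assumes "katetov M I p k" "i \<in> I"
  shows "0 \<le> k i" "k i \<le> 1"
    and "j \<in> I \<Longrightarrow> k i \<le> k j + mdist M (p i) (p j)"
    and "j \<in> I \<Longrightarrow> mdist M (p i) (p j) \<le> k i + k j"
  using assms unfolding katetov_def by (fastforce simp: abs_le_iff)+

lemma katetov_subset: "katetov M I p k \<Longrightarrow> J \<subseteq> I \<Longrightarrow> katetov M J p k"
  unfolding katetov_def by blast

text \<open>The extended space is realised on natural numbers inside the reals, \<open>m\<close> being the new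
  point, because universality only speaks about metrics on the reals.\<close>

lemma extension_distinct:
  fixes k :: "nat \<Rightarrow> real"
  assumes U: "metric_structure M" "urysohn_universal M" "ultrahomogeneous M"
    and I: "finite I" "m \<notin> I" "inj_on p I" "p ` I \<subseteq> mspace M"
    and k: "katetov M I p k" and pos: "\<And>i. i \<in> I \<Longrightarrow> k i > 0"
  shows "\<exists>y\<in>mspace M. \<forall>i\<in>I. mdist M (p i) y = k i"
proof -
  interpret MM: Metric_space "mspace M" "mdist M" by simp
  \<comment> \<open>The absolute values matter only off \<open>I\<close>: the locale
    \<open>Metric_space\<close> asks for nonnegativity at all pairs, not just on the
    carrier.\<close>
  define D where "D i j = (if i = j then 0 else if i = m then \<bar>k j\<bar> else if j = m then \<bar>k i\<bar>
      else mdist M (p i) (p j))" for i j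
  define X where "X = real ` insert m I"
  define E where "E r s = D (nat \<lfloor>r\<rfloor>) (nat \<lfloor>s\<rfloor>)" for r s :: real
  have [simp]: "E (real i) (real j) = D i j" for i j by (simp add: E_def)
  have pM: "p i \<in> mspace M" if "i \<in> I" for i using that I by auto
  have d0: "mdist M (p i) (p j) = 0 \<longleftrightarrow> i = j" if "i \<in> I" "j \<in> I" for i j
    using pM that I(3) by (auto simp: inj_on_eq_iff)
  have [simp]: "\<bar>k i\<bar> = k i" if "i \<in> I" for i using pos[OF that] by simp
  have D_nonneg: "0 \<le> D i j" for i j by (auto simp: D_def)
  have D_le1: "D i j \<le> 1" if "i \<in> insert m I" "j \<in> insert m I" for i j
    using that U(1) pM katetovD(2)[OF k] I(2) by (auto simp: D_def metric_structure_def)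
  have D_sym: "D i j = D j i" for i j by (auto simp: D_def MM.commute)
  have D0: "D i j = 0 \<longleftrightarrow> i = j" if "i \<in> insert m I" "j \<in> insert m I" for i j
  proof -
    have "k i \<noteq> 0" if "i \<in> I" for i using pos[OF that] by simp
    then show ?thesis using that d0 I(2) unfolding D_def by auto
  qed
  have D_tri: "D i l \<le> D i j + D j l" if ijl: "i \<in> insert m I" "j \<in> insert m I" "l \<in> insert m I" for i j l
  proof (cases "i = j \<or> j = l \<or> i = l")
    case True
    then show ?thesis using D_nonneg[of i j] D_nonneg[of j l] by (auto simp: D_def)
  next
    case False
    then consider "i = m" "j \<in> I" "l \<in> I" | "j = m" "i \<in> I" "l \<in> I" | "l = m" "i \<in> I" "j \<in> I"
      | "i \<in> I" "j \<in> I" "l \<in> I"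
      using ijl by blast
    then show ?thesis
    proof cases
      case 1
      then show ?thesis using False I(2) katetovD(3)[OF k, of l j] MM.commute[of "p l" "p j"]
        by (auto simp: D_def)
    next
      case 2
      then show ?thesis using False I(2) katetovD(4)[OF k, of i l] by (auto simp: D_def)
    next
      case 3
      then show ?thesis using False I(2) katetovD(3)[OF k, of i j] by (auto simp: D_def)
    next
      case 4
      then show ?thesis using False I(2) pM MM.triangle[of "p i" "p j" "p l"] by (auto simp: D_def)
    qed
  qed
  interpret E: Metric_space X E
  proof
    show "0 \<le> E x y" for x y using D_nonneg by (simp add: E_def)
    show "E x y = E y x" for x y using D_sym by (simp add: E_def)
    show "E x y = 0 \<longleftrightarrow> x = y" if "x \<in> X" "y \<in> X" for x y using that D0 by (auto simp: X_def)
    show "E x z \<le> E x y + E y z" if "x \<in> X" "y \<in> X" "z \<in> X" for x y z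
      using that D_tri D_nonneg by (auto simp: X_def)
  qed
  have finX: "finite X" using I by (simp add: X_def)
  let ?P = "metric (X, E)"
  have "mcomplete_of ?P" 
    using finX E.compact_space_imp_mcomplete
    by (simp add: mcomplete_of_def compact_space_def finite_imp_compactin)
  moreover have "separable_space (mtopology_of ?P)"
    using finX closure_of_topspace[of E.mtopology]
    by (auto simp: mtopology_of_def separable_space_def intro!: exI[of _ X] countable_finite)
  moreover have "\<forall>x\<in>X. \<forall>y\<in>X. E x y \<le> 1" using D_le1 by (auto simp: X_def)
  ultimately obtain h where h: "isometric_on X ?P M h"
    using U(2) unfolding urysohn_universal_def by fastforce
  define q where "q i = h (real i)" for i
  have XI: "real i \<in> X" if "i \<in> insert m I" for i using that by (auto simp: X_def)
  have qM: "q i \<in> mspace M" if "i \<in> insert m I" for i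
    using h XI[OF that] by (auto simp: isometric_on_def q_def)
  have qd: "mdist M (q i) (q j) = D i j" if "i \<in> insert m I" "j \<in> insert m I" for i j
    using h XI[OF that(1)] XI[OF that(2)] by (auto simp: isometric_on_def q_def)
  have q_inj: "inj_on q I"
    using qd D0 qM by (auto simp: inj_on_def) (metis MM.mdist_zero insertCI)
  \<comment> \<open>Ultrahomogeneity moves the embedded copies \<open>q i\<close> back onto the
    points \<open>p i\<close>; the extension \<open>F\<close> carries the new point
    \<open>q m\<close> along.\<close>
  define f where "f = p \<circ> inv_into I q"
  have f: "f (q i) = p i" if "i \<in> I" for i using that q_inj by (simp add: f_def)
  have "isometric_on (q ` I) M M f"
    unfolding isometric_on_def using pM qd I(2) by (auto simp: f D_def)
  moreover have "f ` (q ` I) = p ` I" by (auto simp: f image_iff)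
  ultimately obtain F where F: "isometric_on (mspace M) M M F" "\<forall>x\<in>q ` I. F x = f x"
    using U(3) I qM unfolding ultrahomogeneous_def
    by (metis (no_types, lifting) finite_imageI image_subsetI insertCI)
  have "mdist M (p i) (F (q m)) = k i" if "i \<in> I" for i
  proof -
    have "p i = F (q i)" using F(2) f that by simp
    then have "mdist M (p i) (F (q m)) = mdist M (q i) (q m)"
      using F(1) qM that unfolding isometric_on_def by simp
    then show ?thesis using qd that I(2) by (auto simp: D_def)
  qed
  moreover have "F (q m) \<in> mspace M" using F(1) qM by (auto simp: isometric_on_def)
  ultimately show ?thesis by blast
qed

text \<open>Removes the side conditions of \<open>extension_distinct\<close>: where \<open>k\<close>
  vanishes, the point there is already a solution, and repeated points can be thinned out because
  \<open>k\<close> agrees on them.\<close>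

lemma extension_finite:
  fixes k :: "nat \<Rightarrow> real"
  assumes U: "metric_structure M" "urysohn_universal M" "ultrahomogeneous M"
    and p: "\<And>i. i < m \<Longrightarrow> p i \<in> mspace M" and k: "katetov M {..<m} p k"
  shows "\<exists>y\<in>mspace M. \<forall>i<m. mdist M (p i) y = k i"
proof (cases "\<exists>i<m. k i = 0")
  case True
  then obtain i where i: "i < m" "k i = 0" by blast
  have "mdist M (p j) (p i) = k j" if "j < m" for j
    using katetovD(3)[OF k, of j i] katetovD(4)[OF k, of j i] i that by auto
  then show ?thesis using p i by blast
next
  case False
  interpret MM: Metric_space "mspace M" "mdist M" by simp
  obtain I where I: "I \<subseteq> {..<m}" "inj_on p I" "p ` {..<m} = p ` I"
    by (metis order_refl subset_image_inj)
  have "\<exists>y\<in>mspace M. \<forall>i\<in>I. mdist M (p i) y = k i"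
  proof (rule extension_distinct[OF U])
    show "finite I" using I(1) finite_subset by blast
    show "m \<notin> I" "p ` I \<subseteq> mspace M" using I(1) p by auto
    show "katetov M I p k" using katetov_subset k I(1) by blast
    show "0 < k i" if "i \<in> I" for i
      using that I(1) False katetovD(1)[OF k, of i] by fastforce
  qed fact
  then obtain y where y: "y \<in> mspace M" "\<And>i. i \<in> I \<Longrightarrow> mdist M (p i) y = k i" by blast
  have "mdist M (p i) y = k i" if i: "i < m" for i
  proof -
    obtain j where j: "j \<in> I" "p i = p j" using I(3) i by blast
    then have "j < m" using I(1) by auto
    then have "k i = k j"
      using katetovD(3)[OF k, of j i] katetovD(3)[OF k, of i j] i j p by simp
    then show ?thesis using y j by simp
  qed
  then show ?thesis using y by blast
qed

text \<open>Total violation of the Katetov inequalities by \<open>k\<close> over a distance matrix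
  \<open>D\<close>. Unlike the property itself it is a continuous quantity and can occur inside a
  connective.\<close>

definition defect :: "nat \<Rightarrow> (nat \<Rightarrow> nat \<Rightarrow> real) \<Rightarrow> (nat \<Rightarrow> real) \<Rightarrow> real" where
  "defect m D k = (\<Sum>i<m. \<Sum>j<m. max 0 (\<bar>k i - k j\<bar> - D i j) + max 0 (D i j - k i - k j))"

lemma defect_ge:
  assumes "i < m" "j < m"
  shows "k i \<le> k j + D i j + defect m D k" "D i j \<le> k i + k j + defect m D k"
proof -
  let ?t = "\<lambda>i j. max 0 (\<bar>k i - k j\<bar> - D i j) + max 0 (D i j - k i - k j)"
  have "?t i j \<le> (\<Sum>j<m. ?t i j)" using assms by (intro member_le_sum) auto
  also have "\<dots> \<le> defect m D k"
    unfolding defect_def using assms by (intro member_le_sum) (auto intro!: sum_nonneg)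
  finally have "?t i j \<le> defect m D k" .
  then show "k i \<le> k j + D i j + defect m D k" "D i j \<le> k i + k j + defect m D k" by linarith+
qed

text \<open>Repairing \<open>k\<close> costs at most its defect \<open>\<Delta>\<close>.
  \<open>F\<close> is the largest 1-Lipschitz minorant of \<open>k\<close>; it lies between
  \<open>k - \<Delta>\<close> and \<open>k\<close> and satisfies
  \<open>?d i j \<le> F i + F j + 2 * \<Delta>\<close>. Adding \<open>\<Delta>\<close> and capping
  at 1 therefore gives a Katetov function \<open>k'\<close> within \<open>\<Delta>\<close> of
  \<open>k\<close>, to which \<open>extension_finite\<close> applies.\<close>

lemma extension_with_defect:
  fixes k :: "nat \<Rightarrow> real"
  assumes U: "metric_structure M" "urysohn_universal M" "ultrahomogeneous M"
    and p: "\<And>i. i < m \<Longrightarrow> p i \<in> mspace M" and k: "\<And>i. i < m \<Longrightarrow> 0 \<le> k i \<and> k i \<le> 1"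
  shows "\<exists>y\<in>mspace M. \<forall>i<m. \<bar>mdist M (p i) y - k i\<bar> \<le> defect m (\<lambda>i j. mdist M (p i) (p j)) k"
proof (cases "m = 0")
  case True
  then show ?thesis using U(1) by (auto simp: metric_structure_def)
next
  case False
  interpret MM: Metric_space "mspace M" "mdist M" by simp
  let ?d = "\<lambda>i j. mdist M (p i) (p j)"
  define \<Delta> where "\<Delta> = defect m ?d k"
  have \<Delta>: "k i \<le> k j + ?d i j + \<Delta>" "?d i j \<le> k i + k j + \<Delta>" if "i < m" "j < m" for i j
    using defect_ge[OF that] by (auto simp: \<Delta>_def)
  have \<Delta>0: "\<Delta> \<ge> 0" unfolding \<Delta>_def defect_def by (intro sum_nonneg) auto
  define F where "F i = (MIN j\<in>{..<m}. k j + ?d i j)" for i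
  have F_le: "F i \<le> k j + ?d i j" if "j < m" for i j
    unfolding F_def using that by (intro Min_le) auto
  have F_ex: "\<exists>j<m. F i = k j + ?d i j" for i
  proof -
    have "F i \<in> (\<lambda>j. k j + ?d i j) ` {..<m}" unfolding F_def using False by (intro Min_in) auto
    then show ?thesis by auto
  qed
  define k' where "k' i = min 1 (F i + \<Delta>)" for i
  have tri: "?d i l \<le> ?d i j + ?d j l" if "i < m" "j < m" "l < m" for i j l
    using that p by (intro MM.triangle) auto
  have F0: "F i \<ge> 0" if "i < m" for i
    using F_ex[of i] k by (metis MM.nonneg add_nonneg_nonneg)
  have F_lip: "F i \<le> F j + ?d i j" if "i < m" "j < m" for i j
  proof -
    obtain l where "l < m" "F j = k l + ?d j l" using F_ex by blast
    then show ?thesis using F_le[of l i] tri[of i j l] that by linarith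
  qed
  have F_sum: "?d i j \<le> F i + F j + 2 * \<Delta>" if "i < m" "j < m" for i j
  proof -
    obtain l where l: "l < m" "F i = k l + ?d i l" using F_ex by blast
    obtain l' where l': "l' < m" "F j = k l' + ?d j l'" using F_ex by blast
    show ?thesis
      using \<Delta>(2)[OF l(1) l'(1)] tri[of i l j] tri[of l l' j] l l' that \<Delta>0
        MM.commute[of "p j" "p l'"] by linarith
  qed
  have "katetov M {..<m} p k'"
    unfolding katetov_def
  proof (intro conjI ballI)
    fix i j assume ij: "i \<in> {..<m}" "j \<in> {..<m}"
    show "0 \<le> k' i" "k' i \<le> 1" using F0 ij \<Delta>0 by (auto simp: k'_def)
    show "\<bar>k' i - k' j\<bar> \<le> ?d i j"
      using F_lip[of i j] F_lip[of j i] ij MM.commute[of "p i" "p j"] by (auto simp: k'_def min_def)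
    \<comment> \<open>Covers the capped case: if \<open>k' i\<close> or \<open>k' j\<close> equals
      1, the diameter bound suffices.\<close>
    have "?d i j \<le> 1" using U(1) p ij by (auto simp: metric_structure_def)
    then show "?d i j \<le> k' i + k' j"
      using F_sum[of i j] F0[of i] F0[of j] \<Delta>0 ij by (auto simp: k'_def min_def)
  qed
  then obtain y where y: "y \<in> mspace M" "\<And>i. i < m \<Longrightarrow> mdist M (p i) y = k' i"
    using extension_finite[OF U, of m p k'] p by blast
  have "\<bar>k' i - k i\<bar> \<le> \<Delta>" if "i < m" for i
  proof -
    obtain l where "l < m" "F i = k l + ?d i l" using F_ex by blast
    then have "k i \<le> F i + \<Delta>" using \<Delta>(1)[of i l] that by linarith
    moreover have "F i \<le> k i" using F_le[of i i] p that by simp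
    ultimately show ?thesis using k[OF that] \<Delta>0 by (auto simp: k'_def min_def)
  qed
  then show ?thesis using y unfolding \<Delta>_def by (metis (no_types, lifting))
qed

section \<open>Expressing the extension property by a sentence\<close>

lemma foldr_SupF [simp]:
  "wf_form (foldr SupF vs \<phi>) \<longleftrightarrow> wf_form \<phi>"
  "params (foldr SupF vs \<phi>) = params \<phi>"
  "free_vars (foldr SupF vs \<phi>) = free_vars \<phi> - set vs"
  by (induction vs) auto

lemma val_foldr_SupF_le:
  assumes "mspace M \<noteq> {}"
    and "\<And>e'. (\<And>v. v \<in> set vs \<Longrightarrow> e' v \<in> mspace M) \<Longrightarrow> (\<And>v. v \<notin> set vs \<Longrightarrow> e' v = e v) \<Longrightarrow>
      val M \<phi> e' \<le> c"
  shows "val M (foldr SupF vs \<phi>) e \<le> c"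
  using assms(2)
proof (induction vs arbitrary: e)
  case Nil
  then show ?case by simp
next
  case (Cons v vs)
  have "val M (foldr SupF vs \<phi>) (e(v := a)) \<le> c" if a: "a \<in> mspace M" for a
  proof (rule Cons.IH)
    fix e' assume e': "\<And>w. w \<in> set vs \<Longrightarrow> e' w \<in> mspace M" "\<And>w. w \<notin> set vs \<Longrightarrow> e' w = (e(v := a)) w"
    show "val M \<phi> e' \<le> c"
    proof (rule Cons.prems)
      show "e' w \<in> mspace M" if "w \<in> set (v # vs)" for w
        using that e' a by (cases "w \<in> set vs") auto
      show "e' w = e w" if "w \<notin> set (v # vs)" for w
        using that e'(2)[of w] by simp
    qed
  qed
  then show ?case using assms(1) by (auto intro: cSUP_least)
qed

lemma val_le_foldr_SupF:
  assumes "metric_structure M" "wf_form \<phi>" "params \<phi> \<subseteq> mspace M"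
    and "\<And>v. v \<in> set vs \<Longrightarrow> e' v \<in> mspace M" "\<And>v. v \<notin> set vs \<Longrightarrow> e' v = e v"
    and "\<And>v. v \<in> free_vars \<phi> \<Longrightarrow> v \<notin> set vs \<Longrightarrow> e v \<in> mspace M"
  shows "val M \<phi> e' \<le> val M (foldr SupF vs \<phi>) e"
  using assms(4-)
proof (induction vs arbitrary: e)
  case Nil
  then have "e' = e" by auto
  then show ?case by simp
next
  case (Cons v vs)
  let ?f = "\<lambda>a. val M (foldr SupF vs \<phi>) (e(v := a))"
  have "val M \<phi> e' \<le> ?f (e' v)"
    by (rule Cons.IH) (use Cons.prems in auto)
  also have "\<dots> \<le> (SUP a\<in>mspace M. ?f a)"
  proof (rule cSUP_upper)
    show "e' v \<in> mspace M" using Cons.prems by simp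
    have "?f a \<le> 1" if "a \<in> mspace M" for a
      by (rule conjunct2[OF val_bounds]) (use assms(1-3) Cons.prems that in auto)
    then show "bdd_above (?f ` mspace M)" by (auto intro!: bdd_aboveI)
  qed
  finally show ?case by simp
qed

text \<open>The pair \<open>(i, j)\<close> of variables is encoded as \<open>i * Suc m + j\<close>. For points \<open>x\<^sub>0, \<dots>, x\<^sub>m\<^sub>-\<^sub>1, y\<close>
  the formula says how badly \<open>y\<close> fails to have distance \<open>k\<^sub>i\<close> to \<open>x\<^sub>i\<close>, up to the failure of \<open>k\<close> to
  be a Katetov function on \<open>x\<close>; it therefore vanishes for a suitable \<open>y\<close> whatever the \<open>x\<^sub>i\<close> are.\<close>

definition extension_form :: "nat \<Rightarrow> (nat \<Rightarrow> real) \<Rightarrow> 'a form" where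
  "extension_form m k = Conn
     (\<lambda>h. min 1 (\<Sum>i<m. max 0 (\<bar>h (i * Suc m + m) - k i\<bar> - defect m (\<lambda>i j. h (i * Suc m + j)) k)))
     (map (\<lambda>p. Dist (Var (p div Suc m)) (Var (p mod Suc m))) [0..<Suc m * Suc m])"

lemma pair_code_less: "i \<le> m \<Longrightarrow> j \<le> m \<Longrightarrow> i * Suc m + j < Suc m * Suc (m::nat)"
  using mult_le_mono1[of i m "Suc m"] by simp

lemma val_extension_form:
  "val M (extension_form m k) e =
     min 1 (\<Sum>i<m. max 0 (\<bar>mdist M (e i) (e m) - k i\<bar> - defect m (\<lambda>i j. mdist M (e i) (e j)) k))"
proof -
  define H where "H = (\<lambda>p\<in>{..<Suc m * Suc m}. mdist M (e (p div Suc m)) (e (p mod Suc m)))"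
  have H: "H (i * Suc m + j) = mdist M (e i) (e j)" if "i \<le> m" "j \<le> m" for i j
  proof -
    have "(i * Suc m + j) div Suc m = i" "(i * Suc m + j) mod Suc m = j"
      using that by (simp_all del: mult_Suc_right)
    then show ?thesis using pair_code_less[OF that] by (simp add: H_def del: mult_Suc_right mult_Suc)
  qed
  have eq: "(\<lambda>i\<in>{..<length [0..<Suc m * Suc m]}. map (\<lambda>\<phi>. val M \<phi> e)
      (map (\<lambda>p. Dist (Var (p div Suc m)) (Var (p mod Suc m))) [0..<Suc m * Suc m]) ! i) = H"
    by (intro ext) (auto simp: H_def restrict_def simp del: upt_Suc mult_Suc)
  have "defect m (\<lambda>i j. H (i * Suc m + j)) k = defect m (\<lambda>i j. mdist M (e i) (e j)) k"
    unfolding defect_def by (intro sum.cong refl) (simp add: H del: mult_Suc_right)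
  moreover have "H (i * Suc m + m) = mdist M (e i) (e m)" if "i < m" for i
    using that by (intro H) auto
  ultimately show ?thesis
    unfolding extension_form_def val.simps length_map eq by (simp del: mult_Suc_right)
qed

lemma extension_form_wf:
  "wf_form (extension_form m k)" "params (extension_form m k) = {}"
  "free_vars (extension_form m k) \<subseteq> {..m}"
proof -
  let ?X = "product_topology (\<lambda>_. top_of_set {0..1::real}) {..<Suc m * Suc m}"
  let ?u = "\<lambda>h. min 1 (\<Sum>i<m. max 0 (\<bar>h (i * Suc m + m) - k i\<bar> -
      defect m (\<lambda>i j. h (i * Suc m + j)) k))"
  have proj: "continuous_map ?X euclideanreal (\<lambda>h. h (i * Suc m + j))" if "i \<le> m" "j \<le> m" for i j
    using pair_code_less[OF that] by (intro continuous_map_coordinate) blast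
  have "continuous_map ?X euclideanreal ?u"
    unfolding defect_def
    by (intro continuous_map_real_min continuous_map_sum continuous_map_real_max
        continuous_map_diff continuous_map_add continuous_map_real_abs proj continuous_map_const[THEN iffD2])
      auto
  moreover have "?u \<in> topspace ?X \<rightarrow> {0..1}"
    unfolding Pi_iff atLeastAtMost_iff
    by (intro ballI conjI min.cobounded1 min.boundedI sum_nonneg max.cobounded1 zero_le_one)
  ultimately have "continuous_map ?X (top_of_set {0..1}) ?u"
    unfolding continuous_map_in_subtopology by blast
  then show "wf_form (extension_form m k)"
    unfolding extension_form_def wf_form.simps length_map length_upt diff_zero by auto
  show "params (extension_form m k) = {}" by (auto simp: extension_form_def)
  show "free_vars (extension_form m k) \<subseteq> {..m}" 
    by (auto simp: extension_form_def less_Suc_eq_le[symmetric] less_mult_imp_div_less simp del: mult_Suc mult_Suc_right)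
qed

section \<open>Transfer of the extension property to the saturated model\<close>

locale urysohn_extension =
  fixes U V :: "'a metric"
  assumes urysohn: "urysohn_sphere U"
    and metric_struct: "metric_structure V"
    and elementary: "elementary_extension U V"
    and saturated: "omega1_saturated V"
begin

sublocale Metric_space "mspace V" "mdist V" by simp

lemma dist_le_1: "x \<in> mspace V \<Longrightarrow> y \<in> mspace V \<Longrightarrow> mdist V x y \<le> 1"
  using metric_struct by (simp add: metric_structure_def)

text \<open>The sentence \<open>\<sigma>\<close>, a supremum over the given points of an infimum
  over the new one, is at most 0 in \<open>U\<close> by \<open>extension_with_defect\<close>, hence
  also in \<open>V\<close>. At Katetov data the subtracted defect vanishes, so a small value of
  \<open>extension_form\<close> bounds the errors themselves.\<close>

lemma extension_approx:
  fixes k :: "nat \<Rightarrow> real"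
  assumes p: "\<And>i. i < m \<Longrightarrow> p i \<in> mspace V" and k: "katetov V {..<m} p k" and "\<epsilon> > 0"
  shows "\<exists>y\<in>mspace V. \<forall>i<m. \<bar>mdist V (p i) y - k i\<bar> < \<epsilon>"
proof -
  define \<phi> :: "'a form" where "\<phi> = InfF m (extension_form m k)"
  have \<phi>: "wf_form \<phi>" "params \<phi> = {}" "free_vars \<phi> \<subseteq> {..<m}"
    using extension_form_wf[of m k] by (auto simp: \<phi>_def)
  define \<sigma> where "\<sigma> = foldr SupF [0..<m] \<phi>"
  have U: "metric_structure U" "urysohn_universal U" "ultrahomogeneous U"
    using urysohn by (auto simp: urysohn_sphere_def)
  have "val U \<sigma> (\<lambda>_. undefined) \<le> 0"
    unfolding \<sigma>_def
  proof (rule val_foldr_SupF_le)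
    show "mspace U \<noteq> {}" using U(1) by (simp add: metric_structure_def)
    fix e assume e: "\<And>v. v \<in> set [0..<m] \<Longrightarrow> e v \<in> mspace U"
    obtain y where y: "y \<in> mspace U"
      "\<And>i. i < m \<Longrightarrow> \<bar>mdist U (e i) y - k i\<bar> \<le> defect m (\<lambda>i j. mdist U (e i) (e j)) k"
      using extension_with_defect[OF U, of m e k] e katetovD(1,2)[OF k] by auto
    have bd: "0 \<le> val U (extension_form m k) (e(m := a))" if "a \<in> mspace U" for a
      unfolding val_extension_form
      by (intro min.boundedI sum_nonneg max.cobounded1 zero_le_one)
    have "defect m (\<lambda>i j. mdist U ((e(m := y)) i) ((e(m := y)) j)) k
        = defect m (\<lambda>i j. mdist U (e i) (e j)) k"
      unfolding defect_def by (intro sum.cong refl) auto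
    then have "val U (extension_form m k) (e(m := y)) \<le> 0"
      unfolding val_extension_form using y(2) by (auto intro!: min.coboundedI2 sum_nonpos)
    then show "val U \<phi> e \<le> 0"
      unfolding \<phi>_def val.simps using bd y(1) by (intro cINF_lower2[OF _ y(1)]) (auto intro!: bdd_belowI)
  qed
  moreover have "val U \<sigma> (\<lambda>_. undefined) = val V \<sigma> (\<lambda>_. undefined)"
  proof -
    \<comment> \<open>A sentence is evaluated at the empty tuple, and
      \<open>\<lambda>_. undefined\<close> is the only element of \<open>tuples 0 U\<close>.\<close>
    have "\<sigma> \<in> formulas {} {..<0}"
      using \<phi> by (auto simp: formulas_def \<sigma>_def)
    then show ?thesis using elementary unfolding elementary_extension_def by fastforce
  qed
  moreover have "val V \<phi> (\<lambda>v. if v < m then p v else undefined) \<le> val V \<sigma> (\<lambda>_. undefined)"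
    unfolding \<sigma>_def using \<phi> p metric_struct by (intro val_le_foldr_SupF) auto
  \<comment> \<open>The value of \<open>extension_form\<close> is capped at 1, so only a bound of at
    most 1 can be carried over to the uncapped sum.\<close>
  ultimately have "\<not> min 1 \<epsilon> \<le> val V \<phi> (\<lambda>v. if v < m then p v else undefined)"
    using \<open>\<epsilon> > 0\<close> by linarith
  moreover have "mspace V \<noteq> {}" using metric_struct by (simp add: metric_structure_def)
  ultimately obtain y where y: "y \<in> mspace V"
      "val V (extension_form m k) ((\<lambda>v. if v < m then p v else undefined)(m := y)) < min 1 \<epsilon>"
    unfolding \<phi>_def val.simps by (meson cINF_greatest not_le)
  let ?e = "(\<lambda>v. if v < m then p v else undefined)(m := y)"
  have "\<bar>k i - k j\<bar> \<le> mdist V (p i) (p j)" "mdist V (p i) (p j) - k i - k j \<le> 0"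
    if "i < m" "j < m" for i j
    using katetovD(3)[OF k, of i j] katetovD(3)[OF k, of j i] katetovD(4)[OF k, of i j] that
    by (simp_all add: abs_le_iff commute[of "p j" "p i"])
  then have 0: "defect m (\<lambda>i j. mdist V (?e i) (?e j)) k = 0"
    unfolding defect_def by (intro sum.neutral ballI) (simp add: max_absorb1)
  have eq: "val V (extension_form m k) ?e = min 1 (\<Sum>i<m. \<bar>mdist V (p i) y - k i\<bar>)"
    unfolding val_extension_form 0 by simp
  have "a < b" if "min 1 a < min 1 b" for a b :: real
    using that by (auto simp: min_def split: if_splits)
  then have sum: "(\<Sum>i<m. \<bar>mdist V (p i) y - k i\<bar>) < \<epsilon>"
    using y(2) unfolding eq by blast
  have "\<bar>mdist V (p i) y - k i\<bar> < \<epsilon>" if "i < m" for i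
    using member_le_sum[of i "{..<m}" "\<lambda>i. \<bar>mdist V (p i) y - k i\<bar>"] that sum by auto
  then show ?thesis using y by blast
qed

text \<open>Approximate solutions for the first \<open>m\<close> points of an enumeration, with
  error below \<open>1 / (m + 1)\<close>, form a sequence whose distances to each point converge to
  the prescribed ones. Saturation realises these limits by one point.\<close>

lemma extension:
  assumes I: "countable I" and p: "\<And>i. i \<in> I \<Longrightarrow> p i \<in> mspace V" and k: "katetov V I p k"
  shows "\<exists>y\<in>mspace V. \<forall>i\<in>I. mdist V y (p i) = k i"
proof (cases "I = {}")
  case True
  then show ?thesis using metric_struct by (auto simp: metric_structure_def)
next
  case False
  define q where "q = from_nat_into I"
  have q: "q i \<in> I" for i unfolding q_def using False by (rule from_nat_into)
  have "\<exists>y\<in>mspace V. \<forall>i<m. \<bar>mdist V (p (q i)) y - k (q i)\<bar> < inverse (real (Suc m))" for m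
  proof (rule extension_approx)
    show "katetov V {..<m} (\<lambda>i. p (q i)) (\<lambda>i. k (q i))"
      using k q unfolding katetov_def by blast
  qed (use p q in auto)
  then obtain y where y: "\<And>m. y m \<in> mspace V"
      "\<And>m i. i < m \<Longrightarrow> \<bar>mdist V (p (q i)) (y m) - k (q i)\<bar> < inverse (real (Suc m))"
    by metis
  let ?e = "\<lambda>m. \<lambda>v\<in>{..<1::nat}. y m"
  define T :: "('a trm \<times> 'a trm) set" where "T = (\<lambda>i. (Var 0, Param (p i))) ` I"
  \<comment> \<open>\<open>saturated_limit_dist\<close> wants the limit as a function of the terms,
    so an index is recovered from the parameter. The choice is harmless because \<open>k\<close>
    agrees on indices of the same point.\<close>
  define i_of where "i_of t = (SOME i. i \<in> I \<and> t = Param (p i))" for t :: "'a trm"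
  have i_of: "i_of (Param (p i)) \<in> I \<and> p (i_of (Param (p i))) = p i" if "i \<in> I" for i
    using someI[of "\<lambda>j. j \<in> I \<and> Param (p i) = Param (p j)" i] that by (auto simp: i_of_def)
  have k_eq: "k i = k j" if "i \<in> I" "j \<in> I" "p i = p j" for i j
    using katetovD(3)[OF k, of i j] katetovD(3)[OF k, of j i] that p by auto
  have "\<exists>e'\<in>tuples 1 V. (\<forall>(\<phi>, r)\<in>{}. val V \<phi> e' \<le> r)
      \<and> (\<forall>(s, t)\<in>T. mdist V (trm_val s e') (trm_val t e') = k (i_of t))"
  proof (rule saturated_limit_dist[OF metric_struct saturated, where B = "p ` I" and e = ?e])
    show "countable (p ` I)" "p ` I \<subseteq> mspace V" using I p by auto
    show "?e m \<in> tuples 1 V" for m using y by auto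
    show "T \<subseteq> terms (p ` I) {..<1} \<times> terms (p ` I) {..<1}" by (auto simp: T_def terms_def)
    fix s t assume "(s, t) \<in> T"
    then obtain i where i: "i \<in> I" "s = Var 0" "t = Param (p i)" by (auto simp: T_def)
    then obtain l where l: "q l = i" using from_nat_into_surj[OF I] by (auto simp: q_def)
    have kk: "k (i_of t) = k i" using i_of[OF i(1)] k_eq[OF _ i(1)] unfolding i(3) by blast
    have "(\<lambda>m. mdist V (p i) (y m) - k i) \<longlonglongrightarrow> 0"
      by (rule Lim_null_comparison[OF _ LIMSEQ_inverse_real_of_nat])
        (use y(2)[of l] l in \<open>auto intro!: eventually_mono[OF eventually_gt_at_top[of l]] less_imp_le\<close>)
    then have "(\<lambda>m. mdist V (p i) (y m)) \<longlonglongrightarrow> k i" by (simp add: LIM_zero_iff)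
    then show "(\<lambda>m. mdist V (trm_val s (?e m)) (trm_val t (?e m))) \<longlonglongrightarrow> k (i_of t)"
      unfolding kk by (simp add: i commute)
  qed auto
  then obtain e' where e': "e' \<in> tuples 1 V"
    "\<And>i. i \<in> I \<Longrightarrow> mdist V (e' 0) (p i) = k (i_of (Param (p i)))"
    by (auto simp: T_def)
  have "mdist V (e' 0) (p i) = k i" if "i \<in> I" for i
    using e'(2)[OF that] k_eq[of "i_of (Param (p i))" i] i_of[OF that] that by simp
  moreover have "e' 0 \<in> mspace V" using e'(1) by auto
  ultimately show ?thesis by blast
qed

section \<open>Invariance of definable functions under isometries over the parameters\<close>

text \<open>The distances from \<open>c\<close>, carried along the partial isometry from
  \<open>e\<close> to \<open>e'\<close>, still satisfy the Katetov inequalities, since these compare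
  them only with distances that the isometry preserves.\<close>

lemma transfer_point:
  assumes "countable B" "B \<subseteq> mspace V" "countable W" "c \<in> mspace V"
    and e: "\<And>v. v \<in> W \<Longrightarrow> e v \<in> mspace V \<and> e' v \<in> mspace V"
    and iso: "\<And>s t. s \<in> terms B W \<Longrightarrow> t \<in> terms B W \<Longrightarrow>
      mdist V (trm_val s e) (trm_val t e) = mdist V (trm_val s e') (trm_val t e')"
  shows "\<exists>c'\<in>mspace V. \<forall>t\<in>terms B W. mdist V c' (trm_val t e') = mdist V c (trm_val t e)"
proof (rule extension)
  show "countable (terms B W)" using assms by (simp add: terms_def)
  show "trm_val t e' \<in> mspace V" if "t \<in> terms B W" for t
    using that assms(2) e by (intro terms_val) auto
  have eM: "trm_val t e \<in> mspace V" if "t \<in> terms B W" for t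
    using that assms(2) e by (intro terms_val) auto
  show "katetov V (terms B W) (\<lambda>t. trm_val t e') (\<lambda>t. mdist V c (trm_val t e))"
    unfolding katetov_def
  proof (intro conjI ballI)
    fix s t assume st: "s \<in> terms B W" "t \<in> terms B W"
    show "0 \<le> mdist V c (trm_val s e)" "mdist V c (trm_val s e) \<le> 1"
      using eM[OF st(1)] assms(4) dist_le_1 by auto
    show "\<bar>mdist V c (trm_val s e) - mdist V c (trm_val t e)\<bar> \<le> mdist V (trm_val s e') (trm_val t e')"
      using mdist_reverse_triangle[of "trm_val s e" c "trm_val t e"] eM st assms(4)
        iso[OF st] by (simp add: commute)
    show "mdist V (trm_val s e') (trm_val t e') \<le> mdist V c (trm_val s e) + mdist V c (trm_val t e)"
      using triangle[of "trm_val s e" c "trm_val t e"] eM st assms(4) iso[OF st] by (simp add: commute)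
  qed
qed

text \<open>The back-and-forth step of quantifier elimination.\<close>

lemma quantifier_step:
  assumes B: "countable B" "B \<subseteq> mspace V" "countable W"
    and e: "\<And>v. v \<in> W \<Longrightarrow> e v \<in> mspace V \<and> e' v \<in> mspace V"
    and iso: "\<And>s t. s \<in> terms B W \<Longrightarrow> t \<in> terms B W \<Longrightarrow>
      mdist V (trm_val s e) (trm_val t e) = mdist V (trm_val s e') (trm_val t e')"
    and F: "\<And>e e'. (\<And>w. w \<in> insert v W \<Longrightarrow> e w \<in> mspace V \<and> e' w \<in> mspace V) \<Longrightarrow>
      (\<And>s t. s \<in> terms B (insert v W) \<Longrightarrow> t \<in> terms B (insert v W) \<Longrightarrow>
        mdist V (trm_val s e) (trm_val t e) = mdist V (trm_val s e') (trm_val t e')) \<Longrightarrow>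
      F e = F e'"
    and v: "v \<notin> W"
  shows "(\<lambda>c. F (e(v := c))) ` mspace V \<subseteq> (\<lambda>c. F (e'(v := c))) ` mspace V"
proof (rule image_subsetI)
  fix c assume c: "c \<in> mspace V"
  obtain c' where c': "c' \<in> mspace V"
      "\<And>t. t \<in> terms B W \<Longrightarrow> mdist V c' (trm_val t e') = mdist V c (trm_val t e)"
    using transfer_point[OF B c e iso] by blast
  have old: "trm_val t (e(v := x)) = trm_val t e" "t \<noteq> Var v" if "t \<in> terms B W" for t x and e :: "nat \<Rightarrow> 'a"
    using that v by (auto simp: terms_def)
  have cases: "t = Var v \<or> t \<in> terms B W" if "t \<in> terms B (insert v W)" for t
    using that by (auto simp: terms_def)
  have "F (e(v := c)) = F (e'(v := c'))"
  proof (rule F)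
    show "(e(v := c)) w \<in> mspace V \<and> (e'(v := c')) w \<in> mspace V" if "w \<in> insert v W" for w
      using that c c'(1) e by auto
    fix s t assume st: "s \<in> terms B (insert v W)" "t \<in> terms B (insert v W)"
    show "mdist V (trm_val s (e(v := c))) (trm_val t (e(v := c)))
        = mdist V (trm_val s (e'(v := c'))) (trm_val t (e'(v := c')))"
      using cases[OF st(1)] cases[OF st(2)] old iso c c' by (auto simp: commute)
  qed
  then show "F (e(v := c)) \<in> (\<lambda>c. F (e'(v := c))) ` mspace V" using c'(1) by blast
qed

text \<open>Quantifier elimination in semantic form. At a quantifier, \<open>quantifier_step\<close>
  in both directions shows that the two sets of values are equal, so suprema and infima agree
  without any estimate.\<close>

lemma val_invariant:
  assumes "params \<phi> \<subseteq> B" "free_vars \<phi> \<subseteq> W" and B: "countable B" "B \<subseteq> mspace V" and "countable W"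
    and "\<And>v. v \<in> W \<Longrightarrow> e v \<in> mspace V \<and> e' v \<in> mspace V"
    and "\<And>s t. s \<in> terms B W \<Longrightarrow> t \<in> terms B W \<Longrightarrow>
      mdist V (trm_val s e) (trm_val t e) = mdist V (trm_val s e') (trm_val t e')"
  shows "val V \<phi> e = val V \<phi> e'"
  using assms(1,2,5-)
proof (induction \<phi> arbitrary: W e e')
  case (Dist s t)
  have "s \<in> terms B W" "t \<in> terms B W"
    using Dist.prems(1,2) by (cases s; cases t; force simp: terms_def)+
  then show ?case using Dist.prems(5) by simp
next
  case (Conn u fs)
  have "val V (fs ! i) e = val V (fs ! i) e'" if "i < length fs" for i
  proof -
    have mem: "fs ! i \<in> set fs" using that by simp
    show ?thesis
      by (rule Conn.IH[OF mem _ _ Conn.prems(3-5)]) (use Conn.prems(1,2) mem in auto)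
  qed
  then have "(\<lambda>i\<in>{..<length fs}. map (\<lambda>\<phi>. val V \<phi> e) fs ! i)
      = (\<lambda>i\<in>{..<length fs}. map (\<lambda>\<phi>. val V \<phi> e') fs ! i)"
    by (intro ext) (simp add: restrict_def)
  then show ?case by simp
next
  case (SupF v \<phi>)
  \<comment> \<open>The bound variable may also belong to \<open>W\<close>; its old value gets
    overwritten and must not constrain the new point.\<close>
  let ?W = "W - {v}"
  have F: "val V \<phi> d = val V \<phi> d'"
    if "\<And>w. w \<in> insert v ?W \<Longrightarrow> d w \<in> mspace V \<and> d' w \<in> mspace V"
      "\<And>s t. s \<in> terms B (insert v ?W) \<Longrightarrow> t \<in> terms B (insert v ?W) \<Longrightarrow>
        mdist V (trm_val s d) (trm_val t d) = mdist V (trm_val s d') (trm_val t d')" for d d'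
    by (rule SupF.IH[of "insert v ?W"]) (use SupF.prems that in auto)
  have sub: "s \<in> terms B W" if "s \<in> terms B ?W" for s using that by (auto simp: terms_def)
  have "(\<lambda>c. val V \<phi> (e(v := c))) ` mspace V = (\<lambda>c. val V \<phi> (e'(v := c))) ` mspace V"
  proof (rule antisym)
    show "(\<lambda>c. val V \<phi> (e(v := c))) ` mspace V \<subseteq> (\<lambda>c. val V \<phi> (e'(v := c))) ` mspace V"
      by (rule quantifier_step[where W = ?W, OF B _ _ _ F])
        (use SupF.prems sub in auto)
    show "(\<lambda>c. val V \<phi> (e'(v := c))) ` mspace V \<subseteq> (\<lambda>c. val V \<phi> (e(v := c))) ` mspace V"
      by (rule quantifier_step[where W = ?W, OF B _ _ _ F])
        (use SupF.prems sub in auto)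
  qed
  then show ?case by simp
next
  case (InfF v \<phi>)
  let ?W = "W - {v}"
  have F: "val V \<phi> d = val V \<phi> d'"
    if "\<And>w. w \<in> insert v ?W \<Longrightarrow> d w \<in> mspace V \<and> d' w \<in> mspace V"
      "\<And>s t. s \<in> terms B (insert v ?W) \<Longrightarrow> t \<in> terms B (insert v ?W) \<Longrightarrow>
        mdist V (trm_val s d) (trm_val t d) = mdist V (trm_val s d') (trm_val t d')" for d d'
    by (rule InfF.IH[of "insert v ?W"]) (use InfF.prems that in auto)
  have sub: "s \<in> terms B W" if "s \<in> terms B ?W" for s using that by (auto simp: terms_def)
  have "(\<lambda>c. val V \<phi> (e(v := c))) ` mspace V = (\<lambda>c. val V \<phi> (e'(v := c))) ` mspace V"
  proof (rule antisym)
    show "(\<lambda>c. val V \<phi> (e(v := c))) ` mspace V \<subseteq> (\<lambda>c. val V \<phi> (e'(v := c))) ` mspace V"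
      by (rule quantifier_step[where W = ?W, OF B _ _ _ F])
        (use InfF.prems sub in auto)
    show "(\<lambda>c. val V \<phi> (e'(v := c))) ` mspace V \<subseteq> (\<lambda>c. val V \<phi> (e(v := c))) ` mspace V"
      by (rule quantifier_step[where W = ?W, OF B _ _ _ F])
        (use InfF.prems sub in auto)
  qed
  then show ?case by simp
qed

lemma terms_isometry:
  assumes "\<And>v w. v \<in> W \<Longrightarrow> w \<in> W \<Longrightarrow> mdist V (e v) (e w) = mdist V (e' v) (e' w)"
    and "\<And>v b. v \<in> W \<Longrightarrow> b \<in> B \<Longrightarrow> mdist V (e v) b = mdist V (e' v) b"
    and "s \<in> terms B W" "t \<in> terms B W"
  shows "mdist V (trm_val s e) (trm_val t e) = mdist V (trm_val s e') (trm_val t e')"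
  using assms(3,4) assms(1,2) commute by (auto simp: terms_def)

lemma dist_tendsto:
  assumes "\<And>m. a m \<in> mspace V" "a' \<in> mspace V" "\<And>m. b m \<in> mspace V" "b' \<in> mspace V"
    and "(\<lambda>m. mdist V (a m) a') \<longlonglongrightarrow> 0" "(\<lambda>m. mdist V (b m) b') \<longlonglongrightarrow> 0"
  shows "(\<lambda>m. mdist V (a m) (b m)) \<longlonglongrightarrow> mdist V a' b'"
proof -
  have "\<bar>mdist V (a m) (b m) - mdist V a' b'\<bar> \<le> mdist V (a m) a' + mdist V (b m) b'" for m
    using triangle[of "a m" a' "b m", OF assms(1,2,3)] triangle[of a' b' "b m", OF assms(2,4,3)]
      triangle[of a' "a m" b', OF assms(2,1,4)] triangle[of "a m" "b m" b', OF assms(1,3,4)]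
      commute[of a' "a m"] commute[of b' "b m"] by linarith
  then have "\<forall>\<^sub>F m in sequentially. norm (mdist V (a m) (b m) - mdist V a' b')
      \<le> mdist V (a m) a' + mdist V (b m) b'"
    unfolding real_norm_def by (intro always_eventually allI)
  moreover have "(\<lambda>m. mdist V (a m) a' + mdist V (b m) b') \<longlonglongrightarrow> 0"
    using tendsto_add[OF assms(5,6)] by simp
  ultimately have "(\<lambda>m. mdist V (a m) (b m) - mdist V a' b') \<longlonglongrightarrow> 0"
    by (rule Lim_null_comparison)
  then show ?thesis by (simp only: LIM_zero_iff)
qed

end

text \<open>Sequential compactness of the cube of all sequences in \<open>{0..1}\<close>: it is
  compact by Tychonoff, and its topology is first countable.\<close>

lemma diagonal_convergent_subsequence:
  fixes f :: "nat \<Rightarrow> nat \<Rightarrow> real"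
  assumes "\<And>m i. f m i \<in> {0..1}"
  shows "\<exists>r. strict_mono r \<and> (\<forall>i. convergent (\<lambda>m. f (r m) i))"
proof -
  have "compactin (product_topology (\<lambda>_. euclidean) UNIV) (UNIV \<rightarrow>\<^sub>E {0..1 :: real} :: (nat \<Rightarrow> real) set)"
    unfolding compactin_PiE by simp
  then have "compact (UNIV \<rightarrow>\<^sub>E {0..1} :: (nat \<Rightarrow> real) set)"
    by (simp only: euclidean_product_topology compactin_euclidean_iff)
  then have "seq_compact (UNIV \<rightarrow>\<^sub>E {0..1} :: (nat \<Rightarrow> real) set)"
    by (rule compact_imp_seq_compact)
  moreover have "\<forall>m. f m \<in> UNIV \<rightarrow>\<^sub>E {0..1}"
    unfolding PiE_UNIV_domain using assms by auto
  ultimately obtain l r where lr: "strict_mono r" "(f \<circ> r) \<longlonglongrightarrow> l"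
    by (rule seq_compactE)
  have "(\<lambda>m. f (r m) i) \<longlonglongrightarrow> l i" for i
  proof -
    have "continuous_on UNIV (\<lambda>h :: nat \<Rightarrow> real. h i)"
      by (rule continuous_on_product_coordinates)
    then have "isCont (\<lambda>h :: nat \<Rightarrow> real. h i) l"
      using continuous_on_eq_continuous_at[OF open_UNIV] by blast
    then show ?thesis using isCont_tendsto_compose[OF _ lr(2)] by (simp add: o_def)
  qed
  then have "convergent (\<lambda>m. f (r m) i)" for i by (rule convergentI)
  then show ?thesis using lr(1) by blast
qed

text \<open>On the side of \<open>V\<close>, all information on \<open>g\<close> is that its graph
  is the zero set of \<open>P\<close>, a uniform limit of formulas over \<open>A\<close>.\<close>

locale definable_graph = urysohn_extension +
  fixes A :: "'a set" and n :: nat and g :: "(nat \<Rightarrow> 'a) \<Rightarrow> 'a"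
    and \<phi> :: "nat \<Rightarrow> 'a form" and P :: "(nat \<Rightarrow> 'a) \<times> 'a \<Rightarrow> real"
  assumes countable_A: "countable A" and A_sub: "A \<subseteq> mspace V"
    and g_in: "g \<in> tuples n V \<rightarrow> mspace V"
    and form: "\<And>k. \<phi> k \<in> formulas A {..n}"
    and lim: "uniform_limit (tuples n V \<times> mspace V) (\<lambda>k (x, y). val V (\<phi> k) (x(n := y))) P sequentially"
    and zero: "\<And>x y. x \<in> tuples n V \<Longrightarrow> y \<in> mspace V \<Longrightarrow> P (x, y) = 0 \<longleftrightarrow> y = g x"
begin

lemma g_mem [simp]: "x \<in> tuples n V \<Longrightarrow> g x \<in> mspace V"
  using g_in by (rule funcset_mem)

lemma tuple_mem: "x \<in> tuples N V \<Longrightarrow> i < N \<Longrightarrow> x i \<in> mspace V"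
  using PiE_mem[of x "{..<N}" "\<lambda>_. mspace V" i] by simp

lemma restrict_tuple: "(\<And>i. i < N \<Longrightarrow> x i \<in> mspace V) \<Longrightarrow> restrict x {..<N} \<in> tuples N V"
  unfolding restrict_PiE_iff by blast

text \<open>Equal distances give equal values of every \<open>\<phi> k\<close> by
  \<open>val_invariant\<close>, hence of \<open>P\<close>, whose zeros are the graph.\<close>

lemma graph_invariant:
  assumes x: "x \<in> tuples n V" "x' \<in> tuples n V" and y: "y \<in> mspace V" "y' \<in> mspace V"
    and "\<And>i j. i < n \<Longrightarrow> j < n \<Longrightarrow> mdist V (x i) (x j) = mdist V (x' i) (x' j)"
    and "\<And>i a. i < n \<Longrightarrow> a \<in> A \<Longrightarrow> mdist V (x i) a = mdist V (x' i) a"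
    and "\<And>i. i < n \<Longrightarrow> mdist V y (x i) = mdist V y' (x' i)"
    and "\<And>a. a \<in> A \<Longrightarrow> mdist V y a = mdist V y' a"
    and "y = g x"
  shows "y' = g x'"
proof -
  have "val V (\<phi> k) (x(n := y)) = val V (\<phi> k) (x'(n := y'))" for k
  proof (rule val_invariant[where B = A and W = "{..n}"])
    show "(x(n := y)) v \<in> mspace V \<and> (x'(n := y')) v \<in> mspace V" if "v \<in> {..n}" for v
      using that tuple_mem[OF x(1)] tuple_mem[OF x(2)] y by auto
    show "mdist V (trm_val s (x(n := y))) (trm_val t (x(n := y)))
        = mdist V (trm_val s (x'(n := y'))) (trm_val t (x'(n := y')))"
      if "s \<in> terms A {..n}" "t \<in> terms A {..n}" for s t
    proof (rule terms_isometry[OF _ _ that])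
      show "mdist V ((x(n := y)) v) ((x(n := y)) w) = mdist V ((x'(n := y')) v) ((x'(n := y')) w)"
        if "v \<in> {..n}" "w \<in> {..n}" for v w
        using that assms(5,7) y by (auto simp: commute)
      show "mdist V ((x(n := y)) v) a = mdist V ((x'(n := y')) v) a" if "v \<in> {..n}" "a \<in> A" for v a
        using that assms(6,8) by auto
    qed
  qed (use form[of k] countable_A A_sub in \<open>auto simp: formulas_def\<close>)
  then have eq: "(\<lambda>k. val V (\<phi> k) (x(n := y))) = (\<lambda>k. val V (\<phi> k) (x'(n := y')))"
    by simp
  have conv: "(\<lambda>k. val V (\<phi> k) (u(n := z))) \<longlonglongrightarrow> P (u, z)"
    if "u \<in> tuples n V" "z \<in> mspace V" for u z
    using tendsto_uniform_limitI[OF lim, of "(u, z)"] that by simp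
  have "P (x, y) = P (x', y')"
    by (rule LIMSEQ_unique[OF conv[OF x(1) y(1)]]) (unfold eq, rule conv[OF x(2) y(2)])
  then show ?thesis using zero[OF x(1) y(1)] zero[OF x(2) y(2)] \<open>y = g x\<close> by simp
qed

text \<open>Closedness of the graph under limits of distance patterns. An index \<open>K l\<close>
  with uniform error below \<open>1 / (l + 1)\<close> turns membership in the graph into the bounds
  \<open>\<phi> (K l) \<le> 1 / (l + 1)\<close>, which saturation preserves; conversely, all these
  bounds together force \<open>P = 0\<close>. Coordinates beyond \<open>n\<close> carry auxiliary
  points.\<close>

lemma graph_limit:
  assumes "n < N" and B: "countable B" "A \<subseteq> B" "B \<subseteq> mspace V"
    and e: "\<And>m. e m \<in> tuples N V" and graph: "\<And>m. e m n = g (restrict (e m) {..<n})"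
    and T: "T \<subseteq> terms B {..<N} \<times> terms B {..<N}"
    and L: "\<And>s t. (s, t) \<in> T \<Longrightarrow> (\<lambda>m. mdist V (trm_val s (e m)) (trm_val t (e m))) \<longlonglongrightarrow> L s t"
  shows "\<exists>e'\<in>tuples N V. e' n = g (restrict e' {..<n})
      \<and> (\<forall>(s, t)\<in>T. mdist V (trm_val s e') (trm_val t e') = L s t)"
proof -
  have "\<exists>k. \<forall>z\<in>tuples n V \<times> mspace V.
      \<bar>(case z of (x, y) \<Rightarrow> val V (\<phi> k) (x(n := y))) - P z\<bar> < inverse (real (Suc l))"
    (is "\<exists>k. ?Q l k") for l
  proof -
    have "inverse (real (Suc l)) > 0" by simp
    then have "\<forall>\<^sub>F k in sequentially. \<forall>z\<in>tuples n V \<times> mspace V.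
        dist (case z of (x, y) \<Rightarrow> val V (\<phi> k) (x(n := y))) (P z) < inverse (real (Suc l))"
      using lim unfolding uniform_limit_iff by blast
    then show ?thesis
      unfolding dist_real_def by (rule eventually_happens[THEN disjE]) auto
  qed
  then obtain K where K0: "\<And>l. ?Q l (K l)" by metis
  have K: "\<bar>val V (\<phi> (K l)) (x(n := y)) - P (x, y)\<bar> < inverse (real (Suc l))"
    if "x \<in> tuples n V" "y \<in> mspace V" for l x y
    using bspec[OF K0, of "(x, y)"] that by (simp add: fun_upd_def)
  define \<Gamma> where "\<Gamma> = range (\<lambda>l. (\<phi> (K l), inverse (real (Suc l))))"
  have part: "restrict f {..<n} \<in> tuples n V" "f n \<in> mspace V" if "f \<in> tuples N V" for f
    using tuple_mem[OF that] \<open>n < N\<close> by (auto intro: restrict_tuple)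
  \<comment> \<open>Tuples here have \<open>N > n\<close> entries, whereas the formulas see only the
    entries up to \<open>n\<close>.\<close>
  have val_part: "val V (\<phi> k) f = val V (\<phi> k) ((restrict f {..<n})(n := f n))"
    if "f \<in> tuples N V" for f k
  proof (rule val_invariant[where B = A and W = "{..n}"])
    show "f v \<in> mspace V \<and> ((restrict f {..<n})(n := f n)) v \<in> mspace V" if "v \<in> {..n}" for v
      using that tuple_mem[OF \<open>f \<in> tuples N V\<close>] \<open>n < N\<close> by auto
    show "mdist V (trm_val s f) (trm_val t f) = mdist V (trm_val s ((restrict f {..<n})(n := f n)))
        (trm_val t ((restrict f {..<n})(n := f n)))" if "s \<in> terms A {..n}" "t \<in> terms A {..n}" for s t
      by (rule terms_isometry[OF _ _ that]) auto
  qed (use form[of k] countable_A A_sub in \<open>auto simp: formulas_def\<close>)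
  have "\<exists>e'\<in>tuples N V. (\<forall>(\<psi>, r)\<in>\<Gamma>. val V \<psi> e' \<le> r)
      \<and> (\<forall>(s, t)\<in>T. mdist V (trm_val s e') (trm_val t e') = L s t)"
  proof (rule saturated_limit_dist[OF metric_struct saturated B(1,3) _ e _ T L])
    fix \<psi> r assume "(\<psi>, r) \<in> \<Gamma>"
    then obtain l where l: "\<psi> = \<phi> (K l)" "r = inverse (real (Suc l))" by (auto simp: \<Gamma>_def)
    show "\<psi> \<in> formulas B {..<N} \<and> 0 \<le> r"
      using form[of "K l"] B(2) \<open>n < N\<close> by (auto simp: l formulas_def)
    show "val V \<psi> (e m) \<le> r" for m
    proof -
      have "P (restrict (e m) {..<n}, e m n) = 0"
        using zero part[OF e] graph by metis
      then show ?thesis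
        using K[OF part[OF e[of m]], of l] by (simp add: l val_part[OF e] abs_less_iff)
    qed
  qed
  then obtain e' where e': "e' \<in> tuples N V"
      "\<And>l. val V (\<phi> (K l)) e' \<le> inverse (real (Suc l))"
      "\<forall>(s, t)\<in>T. mdist V (trm_val s e') (trm_val t e') = L s t"
    by (auto simp: \<Gamma>_def)
  let ?p = "P (restrict e' {..<n}, e' n)"
  \<comment> \<open>One error comes from the approximation by \<open>\<phi> (K l)\<close>, the other
    from the bound on its value.\<close>
  have "\<bar>?p\<bar> \<le> 2 * inverse (real (Suc l))" for l
  proof -
    have "0 \<le> val V (\<phi> (K l)) e'"
      using form[of "K l"] A_sub tuple_mem[OF e'(1)] \<open>n < N\<close>
      by (intro conjunct1[OF val_bounds[OF metric_struct]]) (auto simp: formulas_def subset_iff)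
    then show ?thesis
      using K[OF part[OF e'(1)], of l] e'(2)[of l] val_part[OF e'(1), of "K l"]
      by (simp add: abs_less_iff abs_le_iff)
  qed
  then have "\<bar>?p\<bar> \<le> 0"
    by (intro LIMSEQ_le_const[OF tendsto_mult_right_zero[OF LIMSEQ_inverse_real_of_nat]]) blast
  then have "e' n = g (restrict e' {..<n})" using zero part[OF e'(1)] by simp
  then show ?thesis using e' by blast
qed

section \<open>Possible values of \<open>g\<close>, and its continuity\<close>

definition near_A :: "'a \<Rightarrow> bool" where
  "near_A y \<longleftrightarrow> (\<forall>\<epsilon>>0. \<exists>a\<in>A. mdist V y a < \<epsilon>)"

text \<open>A value away from \<open>A\<close> and from the coordinates could be replaced by a different point with
  the same distances to them.\<close>

lemma value_cases:
  assumes x: "x \<in> tuples n V"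
  shows "near_A (g x) \<or> (\<exists>i<n. g x = x i)"
proof (rule ccontr)
  assume *: "\<not> ?thesis"
  let ?y = "g x"
  obtain \<delta> where \<delta>: "\<delta> > 0" "\<And>a. a \<in> A \<Longrightarrow> \<delta> \<le> mdist V ?y a"
    using * by (auto simp: near_A_def not_less)
  \<comment> \<open>The minimum is at most 1 and at most every distance from \<open>?y\<close> to
    \<open>A\<close> or to a coordinate. The latter makes a new point at distance
    \<open>\<epsilon>\<close> from \<open>?y\<close> compatible with unchanged distances to all of
    these.\<close>
  define S where "S = insert 1 (insert \<delta> ((\<lambda>i. mdist V ?y (x i)) ` {..<n}))"
  define \<epsilon> where "\<epsilon> = Min S"
  have "finite S" "S \<noteq> {}" "\<And>t. t \<in> S \<Longrightarrow> t > 0"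
    using \<delta>(1) * tuple_mem[OF x] g_mem[OF x] by (auto simp: S_def)
  then have "\<epsilon> > 0" "\<And>t. t \<in> S \<Longrightarrow> \<epsilon> \<le> t"
    unfolding \<epsilon>_def by (auto simp: Min_gr_iff)
  then have \<epsilon>: "\<epsilon> \<le> 1" "\<epsilon> \<le> \<delta>" "\<And>i. i < n \<Longrightarrow> \<epsilon> \<le> mdist V ?y (x i)"
    by (auto simp: S_def)
  define B where "B = A \<union> x ` {..<n}"
  have B: "countable B" "B \<subseteq> mspace V" "\<And>b. b \<in> B \<Longrightarrow> \<epsilon> \<le> mdist V ?y b"
    using countable_A A_sub tuple_mem[OF x] \<epsilon> \<delta>(2) by (auto simp: B_def intro: order_trans)
  have y: "?y \<in> mspace V" using x by (rule g_mem)
  then have yB: "?y \<notin> B" using B(3)[of ?y] \<open>\<epsilon> > 0\<close> by auto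
  let ?k = "\<lambda>b. if b = ?y then \<epsilon> else mdist V ?y b"
  have "\<exists>y'\<in>mspace V. \<forall>b\<in>insert ?y B. mdist V y' b = ?k b"
  proof (rule extension)
    show "katetov V (insert ?y B) (\<lambda>b. b) ?k"
      unfolding katetov_def
    proof (intro conjI ballI)
      fix b c assume bc: "b \<in> insert ?y B" "c \<in> insert ?y B"
      then have M: "b \<in> mspace V" "c \<in> mspace V" using B(2) y by auto
      show "0 \<le> ?k b" "?k b \<le> 1" using \<open>\<epsilon> > 0\<close> \<epsilon>(1) dist_le_1 M y by auto
      show "\<bar>?k b - ?k c\<bar> \<le> mdist V b c"
        using bc B(3)[of b] B(3)[of c] \<open>\<epsilon> > 0\<close> M y yB triangle[of ?y b c] triangle[of ?y c b]
        by (auto simp: commute abs_le_iff)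
      show "mdist V b c \<le> ?k b + ?k c"
        using bc B(3)[of b] B(3)[of c] \<open>\<epsilon> > 0\<close> M y yB triangle[of b ?y c]
        by (auto simp: commute)
    qed
  qed (use B y in auto)
  then obtain y' where y': "y' \<in> mspace V" "mdist V y' ?y = \<epsilon>"
      "\<And>b. b \<in> B \<Longrightarrow> mdist V y' b = mdist V ?y b"
    using yB by fastforce
  have "y' = g x"
    by (rule graph_invariant[OF x x y y'(1)]) (use y'(3) in \<open>auto simp: B_def\<close>)
  then show False using y'(2) y \<open>\<epsilon> > 0\<close> by simp
qed

text \<open>Otherwise the distances from \<open>g (x m)\<close> to \<open>g x'\<close> accumulate at
  some \<open>l > 0\<close>. A limit of the configurations consists of a graph point and of a point
  at distance \<open>l\<close> from its value that relates to the arguments as \<open>g x'\<close>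
  does to \<open>x'\<close>. By invariance that point is the value as well, so
  \<open>l = 0\<close>.\<close>

lemma g_continuous:
  assumes x: "\<And>m. x m \<in> tuples n V" and x': "x' \<in> tuples n V"
    and lim_x: "\<And>i. i < n \<Longrightarrow> (\<lambda>m. mdist V (x m i) (x' i)) \<longlonglongrightarrow> 0"
  shows "(\<lambda>m. mdist V (g (x m)) (g x')) \<longlonglongrightarrow> 0"
proof (rule ccontr)
  assume "\<not> ?thesis"
  then obtain \<epsilon> where \<epsilon>: "\<epsilon> > 0" "\<And>N. \<exists>m\<ge>N. \<epsilon> \<le> mdist V (g (x m)) (g x')"
    by (auto simp: LIMSEQ_iff not_less)
  then obtain r where r: "\<And>N. r N \<ge> N" "\<And>N. \<epsilon> \<le> mdist V (g (x (r N))) (g x')"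
    by metis
  have "\<forall>N. mdist V (g (x (r N))) (g x') \<in> {\<epsilon>..1}"
    using r(2) dist_le_1 g_mem[OF x] g_mem[OF x'] by simp
  then obtain l q where l: "l \<in> {\<epsilon>..1}" "strict_mono q"
      "(\<lambda>N. mdist V (g (x (r (q N)))) (g x')) \<longlonglongrightarrow> l"
    by (rule seq_compactE[OF compact_imp_seq_compact[OF compact_Icc]]) (simp add: o_def)
  define z where "z N = x (r (q N))" for N
  have z: "z N \<in> tuples n V" for N using x by (simp add: z_def)
  \<comment> \<open>\<open>r\<close> need not be monotone; \<open>r N \<ge> N\<close> is enough for
    the indices to tend to infinity.\<close>
  have "filterlim (\<lambda>N. r (q N)) sequentially sequentially"
    using r(1) seq_suble[OF l(2)] by (intro filterlim_at_top_mono[OF filterlim_ident] always_eventually allI) (metis order_trans)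
  then have lim_z: "(\<lambda>N. mdist V (z N i) (x' i)) \<longlonglongrightarrow> 0" if "i < n" for i
    unfolding z_def using filterlim_compose[OF lim_x[OF that]] by blast
  \<comment> \<open>Coordinate \<open>n\<close> will hold the varying value and \<open>Suc n\<close>
    the fixed point \<open>g x'\<close>. The former is left out of \<open>W\<close>, as only its
    distance to the latter is controlled.\<close>
  define W where "W = {..<n} \<union> {Suc n}"
  define e where "e N = (\<lambda>v\<in>{..<n + 2}. if v < n then z N v else if v = n then g (z N) else g x')" for N
  \<comment> \<open>The intended limit configuration. Its entry at \<open>n\<close> is a dummy,
    since \<open>n\<close> is not in \<open>W\<close>.\<close>
  define e1 where "e1 v = (if v < n then x' v else g x')" for v
  define T :: "('a trm \<times> 'a trm) set" where "T = insert (Var n, Var (Suc n)) (terms A W \<times> terms A W)"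
  define L where "L s t = (if s = Var n then l else mdist V (trm_val s e1) (trm_val t e1))" for s t
  have e: "e N \<in> tuples (n + 2) V" for N
    unfolding e_def using tuple_mem[OF z[of N]] g_mem[OF z[of N]] g_mem[OF x']
    by (intro restrict_tuple) simp
  have e_part: "restrict (e N) {..<n} = z N" for N
    using PiE_arb[OF z[of N]] by (intro ext) (auto simp: e_def)
  have WN: "w \<in> W \<Longrightarrow> w < n + 2" for w by (auto simp: W_def)
  have e1: "e1 v \<in> mspace V" for v using g_mem[OF x'] tuple_mem[OF x'] by (auto simp: e1_def)
  have "\<exists>e'\<in>tuples (n + 2) V. e' n = g (restrict e' {..<n})
      \<and> (\<forall>(s, t)\<in>T. mdist V (trm_val s e') (trm_val t e') = L s t)"
  proof (rule graph_limit[OF _ countable_A order_refl A_sub e])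
    show "e N n = g (restrict (e N) {..<n})" for N
      unfolding e_part by (simp add: e_def)
    show "T \<subseteq> terms A {..<n + 2} \<times> terms A {..<n + 2}"
      by (auto simp: T_def terms_def W_def)
    fix s t assume "(s, t) \<in> T"
    then consider "s = Var n" "t = Var (Suc n)" | "s \<in> terms A W" "t \<in> terms A W" by (auto simp: T_def)
    then show "(\<lambda>N. mdist V (trm_val s (e N)) (trm_val t (e N))) \<longlonglongrightarrow> L s t"
    proof cases
      case 1
      then show ?thesis using l(3) by (simp add: e_def L_def z_def)
    next
      case 2
      have M: "trm_val u (e N) \<in> mspace V" "trm_val u e1 \<in> mspace V" if "u \<in> terms A W" for u N
        using that A_sub e1 tuple_mem[OF e[of N]] WN by (auto intro!: terms_val)
      have conv: "(\<lambda>N. mdist V (trm_val u (e N)) (trm_val u e1)) \<longlonglongrightarrow> 0"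
        if u: "u \<in> terms A W" for u
      proof -
        consider a where "a \<in> A" "u = Param a" | i where "i < n" "u = Var i" | "u = Var (Suc n)"
          using u by (auto simp: terms_def W_def)
        then show ?thesis
        proof cases
          case 1
          then show ?thesis using A_sub by auto
        next
          case 2
          then show ?thesis using lim_z by (simp add: e_def e1_def)
        next
          case 3
          then show ?thesis using x' by (simp add: e_def e1_def)
        qed
      qed
      have "s \<noteq> Var n" using 2 by (auto simp: terms_def W_def)
      then show ?thesis
        using dist_tendsto[of "\<lambda>N. trm_val s (e N)" "trm_val s e1" "\<lambda>N. trm_val t (e N)" "trm_val t e1"]
          M conv 2 by (simp add: L_def)
    qed
  qed simp
  then obtain e' where e': "e' \<in> tuples (n + 2) V" "e' n = g (restrict e' {..<n})"
      "\<And>s t. (s, t) \<in> T \<Longrightarrow> mdist V (trm_val s e') (trm_val t e') = L s t" by blast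
  have 1: "mdist V (e' n) (e' (Suc n)) = l"
    using e'(3)[of "Var n" "Var (Suc n)"] by (simp add: T_def L_def)
  have d: "mdist V (trm_val s e1) (trm_val t e1) = mdist V (trm_val s e') (trm_val t e')"
    if "s \<in> terms A W" "t \<in> terms A W" for s t
  proof -
    have "s \<noteq> Var n" using that by (auto simp: terms_def W_def)
    then show ?thesis using e'(3)[of s t] that by (simp add: T_def L_def)
  qed
  have var: "Var i \<in> terms A W" if "i < n \<or> i = Suc n" for i using that by (auto simp: terms_def W_def)
  have par: "Param a \<in> terms A W" if "a \<in> A" for a using that by (auto simp: terms_def)
  \<comment> \<open>\<open>e'\<close> reproduces the pattern of \<open>x'\<close> and
    \<open>g x'\<close> over \<open>A\<close>, with coordinate \<open>Suc n\<close> in the role of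
    the value.\<close>
  have "e' (Suc n) = g (restrict e' {..<n})"
  proof (rule graph_invariant[OF x' _ g_mem[OF x']])
    show "restrict e' {..<n} \<in> tuples n V" "e' (Suc n) \<in> mspace V"
      using tuple_mem[OF e'(1)] by (auto intro: restrict_tuple)
    show "mdist V (x' i) (x' j) = mdist V (restrict e' {..<n} i) (restrict e' {..<n} j)"
      if "i < n" "j < n" for i j using d[of "Var i" "Var j"] var that by (simp add: e1_def)
    show "mdist V (x' i) a = mdist V (restrict e' {..<n} i) a" if "i < n" "a \<in> A" for i a
      using d[of "Var i" "Param a"] var par that by (simp add: e1_def)
    show "mdist V (g x') (x' i) = mdist V (e' (Suc n)) (restrict e' {..<n} i)" if "i < n" for i
      using d[of "Var (Suc n)" "Var i"] var that by (simp add: e1_def)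
    show "mdist V (g x') a = mdist V (e' (Suc n)) a" if "a \<in> A" for a
      using d[of "Var (Suc n)" "Param a"] var par that by (simp add: e1_def)
  qed simp
  then have "l = 0" using 1 e'(1,2) by (metis mdist_zero tuple_mem less_add_same_cancel1 zero_less_numeral)
  then show False using l(1) \<epsilon>(1) by simp
qed

section \<open>The dichotomy\<close>

text \<open>A uniform \<open>\<epsilon>\<close>, rather than mere distinctness, yields through
  \<open>separated_value\<close> a gap that survives limits.\<close>

definition separated :: "real \<Rightarrow> (nat \<Rightarrow> 'a) \<Rightarrow> bool" where
  "separated \<epsilon> x \<longleftrightarrow> (\<forall>i<n. \<forall>a\<in>A. \<epsilon> \<le> mdist V (x i) a)
     \<and> (\<forall>i<n. \<forall>j<n. i \<noteq> j \<longrightarrow> \<epsilon> \<le> mdist V (x i) (x j))"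

lemma separated_mono: "separated \<delta> x \<Longrightarrow> \<epsilon> \<le> \<delta> \<Longrightarrow> separated \<epsilon> x"
  unfolding separated_def by (meson order_trans)

text \<open>Both alternatives of \<open>value_cases\<close> keep the value away from
  \<open>x j\<close>: every other coordinate is \<open>\<epsilon>\<close> away by separation, and so
  are the points of \<open>A\<close> that approximate the value.\<close>

lemma separated_value:
  assumes x: "x \<in> tuples n V" and sep: "separated \<epsilon> x" and j: "j < n" and ne: "g x \<noteq> x j"
  shows "\<epsilon> \<le> mdist V (g x) (x j)"
  using value_cases[OF x]
proof
  assume "\<exists>i<n. g x = x i"
  then show ?thesis using sep ne j unfolding separated_def by metis
next
  assume near: "near_A (g x)"
  show ?thesis
  proof (rule field_le_epsilon)
    fix \<eta> :: real assume "\<eta> > 0"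
    then obtain a where a: "a \<in> A" "mdist V (g x) a < \<eta>"
      using near unfolding near_A_def by blast
    have "\<epsilon> \<le> mdist V (x j) a" using sep a(1) j unfolding separated_def by blast
    moreover have "mdist V (x j) a \<le> mdist V (x j) (g x) + mdist V (g x) a"
      using a(1) A_sub by (intro triangle tuple_mem[OF x j] g_mem[OF x]) blast
    ultimately show "\<epsilon> \<le> mdist V (g x) (x j) + \<eta>"
      using a(2) commute[of "x j" "g x"] by linarith
  qed
qed

section \<open>Bisection along midpoints\<close>

lemma upd_tuple: "x \<in> tuples n V \<Longrightarrow> i < n \<Longrightarrow> z \<in> mspace V \<Longrightarrow> x(i := z) \<in> tuples n V"
  using fun_upd_in_PiE[of i "{..<n}" x "\<lambda>_. mspace V"] by (metis PiE_fun_upd insert_absorb lessThan_iff)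

text \<open>The average of two distance functions satisfies the Katetov inequalities. A midpoint
  obtained in this way inherits every lower bound on a distance to \<open>B\<close> that both
  endpoints satisfy, so it can stay clear of \<open>A\<close> and of the other coordinates.\<close>

lemma midpoint:
  assumes B: "countable B" "B \<subseteq> mspace V" and zw: "z \<in> mspace V" "w \<in> mspace V"
  shows "\<exists>m\<in>mspace V. mdist V z m = mdist V z w / 2 \<and> mdist V m w = mdist V z w / 2
      \<and> (\<forall>b\<in>B. mdist V m b = (mdist V z b + mdist V w b) / 2)"
proof -
  let ?B = "insert z (insert w B)"
  let ?k = "\<lambda>b. (mdist V z b + mdist V w b) / 2"
  have M: "b \<in> mspace V" if "b \<in> ?B" for b using that B zw by auto
  have "\<exists>m\<in>mspace V. \<forall>b\<in>?B. mdist V m b = ?k b"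
  proof (rule extension)
    show "katetov V ?B (\<lambda>b. b) ?k"
      unfolding katetov_def
    proof (intro conjI ballI)
      fix b c assume bc: "b \<in> ?B" "c \<in> ?B"
      note M = M[OF bc(1)] M[OF bc(2)]
      show "0 \<le> ?k b" by simp
      show "?k b \<le> 1" using dist_le_1[OF zw(1) M(1)] dist_le_1[OF zw(2) M(1)] by simp
      show "\<bar>?k b - ?k c\<bar> \<le> mdist V b c"
        using triangle[OF zw(1) M] triangle[OF zw(1) M(2,1)] triangle[OF zw(2) M]
          triangle[OF zw(2) M(2,1)] commute[of c b] by (simp add: abs_le_iff field_simps)
      show "mdist V b c \<le> ?k b + ?k c"
        using triangle[OF M(1) zw(1) M(2)] triangle[OF M(1) zw(2) M(2)]
          commute[of b z] commute[of b w] by (simp add: field_simps)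
    qed
  qed (use B M in auto)
  then obtain m where m: "m \<in> mspace V" "\<And>b. b \<in> ?B \<Longrightarrow> mdist V m b = ?k b" by blast
  have "mdist V m z = mdist V z w / 2" "mdist V m w = mdist V z w / 2"
    using m(2)[of z] m(2)[of w] zw commute[of w z] by simp_all
  then show ?thesis using m commute[of m z] by (intro bexI[of _ m]) auto
qed

lemma separated_upd_midpoint:
  assumes "separated \<epsilon> (x(i := z))" "separated \<epsilon> (x(i := w))" "i < n"
    and m: "\<And>b. b \<in> A \<union> x ` {..<n} \<Longrightarrow> mdist V m b = (mdist V z b + mdist V w b) / 2"
  shows "separated \<epsilon> (x(i := m))"
  unfolding separated_def
proof (intro conjI allI ballI impI)
  have avg: "\<epsilon> \<le> mdist V m b" if "\<epsilon> \<le> mdist V z b" "\<epsilon> \<le> mdist V w b" "b \<in> A \<union> x ` {..<n}" for b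
    using m[OF that(3)] that(1,2) by simp
  fix j assume j: "j < n"
  show "\<epsilon> \<le> mdist V ((x(i := m)) j) a" if "a \<in> A" for a
  proof (cases "j = i")
    case True
    have "\<epsilon> \<le> mdist V ((x(i := z)) i) a" "\<epsilon> \<le> mdist V ((x(i := w)) i) a"
      using assms(1-3) that unfolding separated_def by blast+
    then show ?thesis using avg that True by simp
  next
    case False
    have "\<epsilon> \<le> mdist V ((x(i := z)) j) a" using assms(1) j that unfolding separated_def by blast
    then show ?thesis using False by simp
  qed
  have row: "\<epsilon> \<le> mdist V m (x l)" if l: "l < n" "l \<noteq> i" for l
  proof -
    have "\<epsilon> \<le> mdist V ((x(i := z)) i) ((x(i := z)) l)" "\<epsilon> \<le> mdist V ((x(i := w)) i) ((x(i := w)) l)"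
      using assms(1-3) l unfolding separated_def by metis+
    then show ?thesis using avg l by simp
  qed
  show "\<epsilon> \<le> mdist V ((x(i := m)) j) ((x(i := m)) l)" if l: "l < n" "j \<noteq> l" for l
  proof -
    consider "j = i" | "l = i" | "j \<noteq> i" "l \<noteq> i" by blast
    then show ?thesis
    proof cases
      case 1
      then show ?thesis using row[of l] l by simp
    next
      case 2
      then show ?thesis using row[of j] j l commute[of "x j" m] by simp
    next
      case 3
      have "\<epsilon> \<le> mdist V ((x(i := z)) j) ((x(i := z)) l)"
        using assms(1) j l unfolding separated_def by blast
      then show ?thesis using 3 by simp
    qed
  qed
qed

text \<open>Otherwise bisection, using midpoints that keep the tuple separated, produces two sequences
  with a common limit along which \<open>g\<close> behaves differently, contradicting continuity.\<close>

lemma projection_move_one: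
  assumes x: "x \<in> tuples n V" and i: "i < n" and "z \<in> mspace V" "w \<in> mspace V" and \<epsilon>: "\<epsilon> > 0"
    and "separated \<epsilon> (x(i := z))" "separated \<epsilon> (x(i := w))"
    and j: "j < n" and "g (x(i := z)) = (x(i := z)) j"
  shows "g (x(i := w)) = (x(i := w)) j"
proof (rule ccontr)
  assume neg: "\<not> ?thesis"
  define S where "S u \<longleftrightarrow> g (x(i := u)) = (x(i := u)) j" for u
  define Q where "Q p \<longleftrightarrow> fst p \<in> mspace V \<and> snd p \<in> mspace V \<and> separated \<epsilon> (x(i := fst p)) \<and>
      separated \<epsilon> (x(i := snd p)) \<and> S (fst p) \<and> \<not> S (snd p)" for p
  define D where "D = mdist V z w"
  \<comment> \<open>The midpoint replaces the endpoint that agrees with it about \<open>S\<close>.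
    The gap halves and the first endpoint moves by at most half of it, so both endpoints converge to
    one point.\<close>
  have "\<exists>q. Q q \<and> mdist V (fst q) (snd q) = mdist V (fst p) (snd p) / 2 \<and>
      mdist V (fst p) (fst q) \<le> mdist V (fst p) (snd p) / 2" if Q: "Q p" for p
  proof -
    obtain u v where p: "p = (u, v)" by fastforce
    have "countable (A \<union> x ` {..<n})" "A \<union> x ` {..<n} \<subseteq> mspace V"
      using countable_A A_sub tuple_mem[OF x] by auto
    then obtain m where m: "m \<in> mspace V" "mdist V u m = mdist V u v / 2" "mdist V m v = mdist V u v / 2"
        "\<And>b. b \<in> A \<union> x ` {..<n} \<Longrightarrow> mdist V m b = (mdist V u b + mdist V v b) / 2"
      using midpoint[of "A \<union> x ` {..<n}" u v] Q p by (auto simp: Q_def)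
    have sep: "separated \<epsilon> (x(i := m))"
      by (rule separated_upd_midpoint[OF _ _ i m(4)]) (use Q p in \<open>auto simp: Q_def\<close>)
    show ?thesis
    proof (cases "S m")
      case True
      then have "Q (m, v)" using Q p sep m(1) by (simp add: Q_def)
      then show ?thesis using m p by (intro exI[of _ "(m, v)"]) simp
    next
      case False
      then have "Q (u, m)" using Q p sep m(1) by (simp add: Q_def)
      then show ?thesis using m Q p by (intro exI[of _ "(u, m)"]) (simp add: Q_def)
    qed
  qed
  moreover have "Q (z, w)" using assms neg by (simp add: Q_def S_def)
  ultimately obtain p where p: "\<And>k. Q (p k)" "p 0 = (z, w)"
      "\<And>k. mdist V (fst (p (Suc k))) (snd (p (Suc k))) = mdist V (fst (p k)) (snd (p k)) / 2"
      "\<And>k. mdist V (fst (p k)) (fst (p (Suc k))) \<le> mdist V (fst (p k)) (snd (p k)) / 2"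
    using dependent_nat_choice[of "\<lambda>k p. Q p \<and> (k = 0 \<longrightarrow> p = (z, w))"
        "\<lambda>k p q. mdist V (fst q) (snd q) = mdist V (fst p) (snd p) / 2 \<and>
          mdist V (fst p) (fst q) \<le> mdist V (fst p) (snd p) / 2"] by auto
  define a where "a k = fst (p k)" for k
  define b where "b k = snd (p k)" for k
  have ab: "a k \<in> mspace V" "b k \<in> mspace V" "separated \<epsilon> (x(i := b k))" "S (a k)" "\<not> S (b k)" for k
    using p(1)[of k] by (auto simp: Q_def a_def b_def)
  have dab: "mdist V (a k) (b k) = D * (1 / 2) ^ k" for k
    by (induction k) (use p(2,3) in \<open>auto simp: a_def b_def D_def\<close>)
  have step: "mdist V (a k) (a (Suc k)) \<le> D * (1 / 2) ^ k / 2" for k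
    using p(4)[of k] dab[of k] by (simp add: a_def b_def)
  have D0: "D \<ge> 0" by (simp add: D_def)
  \<comment> \<open>The right-hand side is the sum of \<open>l\<close> terms of the geometric series
    that bounds the steps.\<close>
  have tail: "mdist V (a k) (a (k + l)) \<le> D * (1 / 2) ^ k * (1 - (1 / 2) ^ l)" for k l
  proof (induction l)
    case 0
    then show ?case using ab by simp
  next
    case (Suc l)
    have "mdist V (a k) (a (k + Suc l)) \<le> mdist V (a k) (a (k + l)) + mdist V (a (k + l)) (a (k + Suc l))"
      by (intro triangle ab)
    also have "\<dots> \<le> D * (1 / 2) ^ k * (1 - (1 / 2) ^ l) + D * (1 / 2) ^ (k + l) / 2"
      using Suc step[of "k + l"] by simp
    also have "\<dots> = D * (1 / 2) ^ k * (1 - (1 / 2) ^ Suc l)" by (simp add: power_add algebra_simps)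
    finally show ?case .
  qed
  have geo: "(\<lambda>k. D * (1 / 2) ^ k) \<longlonglongrightarrow> 0"
    by (intro tendsto_mult_right_zero LIMSEQ_power_zero) simp
  have "MCauchy a"
    unfolding MCauchy_def
  proof (intro conjI allI impI)
    show "range a \<subseteq> mspace V" using ab by blast
    fix \<eta> :: real assume "\<eta> > 0"
    then obtain N where N: "\<And>k. k \<ge> N \<Longrightarrow> D * (1 / 2) ^ k < \<eta>"
      using order_tendstoD(2)[OF geo] by (auto simp: eventually_sequentially)
    have close: "mdist V (a k) (a (k + l)) < \<eta>" if "N \<le> k" for k l
    proof -
      have "D * (1 / 2) ^ k * (1 - (1 / 2) ^ l) \<le> D * (1 / 2) ^ k * 1"
        using D0 by (intro mult_left_mono) auto
      then show ?thesis using tail[of k l] N[OF that] by linarith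
    qed
    have "mdist V (a k) (a l) < \<eta>" if "N \<le> k" "N \<le> l" for k l
    proof (cases "k \<le> l")
      case True
      then show ?thesis using close[OF that(1), of "l - k"] by simp
    next
      case False
      then show ?thesis using close[OF that(2), of "k - l"] commute[of "a k" "a l"] by simp
    qed
    then show "\<exists>N. \<forall>k l. N \<le> k \<longrightarrow> N \<le> l \<longrightarrow> mdist V (a k) (a l) < \<eta>" by blast
  qed
  moreover have "mcomplete"
    using metric_struct by (simp add: metric_structure_def mcomplete_of_def)
  ultimately obtain c where "limitin mtopology a c sequentially"
    unfolding mcomplete_def by blast
  then have c: "c \<in> mspace V" "(\<lambda>k. mdist V (a k) c) \<longlonglongrightarrow> 0"
    using limitin_metric_dist_null by auto
  have bc: "(\<lambda>k. mdist V (b k) c) \<longlonglongrightarrow> 0"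
  proof (rule tendsto_sandwich[OF _ _ tendsto_const])
    show "\<forall>\<^sub>F k in sequentially. mdist V (b k) c \<le> D * (1 / 2) ^ k + mdist V (a k) c"
    proof (intro always_eventually allI)
      show "mdist V (b k) c \<le> D * (1 / 2) ^ k + mdist V (a k) c" for k
        using triangle[OF ab(2,1) c(1), of k k] commute[of "b k" "a k"] dab[of k] by linarith
    qed
    show "(\<lambda>k. D * (1 / 2) ^ k + mdist V (a k) c) \<longlonglongrightarrow> 0"
      using tendsto_add[OF geo c(2)] by simp
  qed auto
  have upd: "(\<lambda>k. mdist V ((x(i := u k)) l) ((x(i := c)) l)) \<longlonglongrightarrow> 0"
    if "(\<lambda>k. mdist V (u k) c) \<longlonglongrightarrow> 0" "l < n" for u l
    using that tuple_mem[OF x that(2)] by (cases "l = i") auto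
  have T: "x(i := u) \<in> tuples n V" if "u \<in> mspace V" for u using upd_tuple[OF x i that] .
  have mem: "(x(i := u)) j \<in> mspace V" "g (x(i := u)) \<in> mspace V" if "u \<in> mspace V" for u
    using tuple_mem[OF T[OF that] j] g_mem[OF T[OF that]] by auto
  have lim: "(\<lambda>k. mdist V (g (x(i := u k))) ((x(i := u k)) j))
      \<longlonglongrightarrow> mdist V (g (x(i := c))) ((x(i := c)) j)"
    if "\<And>k. u k \<in> mspace V" "(\<lambda>k. mdist V (u k) c) \<longlonglongrightarrow> 0" for u
    by (intro dist_tendsto mem that c(1) upd[OF that(2)] g_continuous T j)
  have "mdist V (g (x(i := a k))) ((x(i := a k)) j) = 0" for k
    using ab(4)[of k] mem[OF ab(1)] by (simp only: S_def mdist_zero)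
  then have "mdist V (g (x(i := c))) ((x(i := c)) j) = 0"
    using LIMSEQ_unique[OF lim[OF ab(1) c(2)]] by (simp only: tendsto_const)
  \<comment> \<open>Along \<open>b\<close> the gap of \<open>separated_value\<close> persists in the
    limit, whereas along \<open>a\<close> the same limit was 0.\<close>
  moreover have "\<epsilon> \<le> mdist V (g (x(i := c))) ((x(i := c)) j)"
  proof (rule LIMSEQ_le_const[OF lim[OF ab(2) bc]], intro exI allI impI)
    show "\<epsilon> \<le> mdist V (g (x(i := b k))) ((x(i := b k)) j)" for k
      using ab(5)[of k] by (intro separated_value[OF T[OF ab(2)] ab(3) j]) (simp only: S_def not_False_eq_True)
  qed
  ultimately show False using \<epsilon> by simp
qed

text \<open>The new point hangs off \<open>y\<close> at distance \<open>\<delta>\<close>, with all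
  other distances measured through \<open>y\<close> and capped at 1.\<close>

lemma perturb_point:
  assumes C: "countable C" "C \<subseteq> mspace V" and y: "y \<in> mspace V" and \<delta>: "0 < \<delta>" "\<delta> \<le> 1"
  shows "\<exists>y'\<in>mspace V. mdist V y' y \<le> \<delta> \<and> (\<forall>c\<in>C. \<delta> \<le> mdist V y' c)"
proof -
  let ?k = "\<lambda>c. min 1 (mdist V y c + \<delta>)"
  have "\<exists>y'\<in>mspace V. \<forall>c\<in>insert y C. mdist V y' c = ?k c"
  proof (rule extension)
    show "katetov V (insert y C) (\<lambda>c. c) ?k"
      unfolding katetov_def
    proof (intro conjI ballI)
      fix b c assume "b \<in> insert y C" "c \<in> insert y C"
      then have M: "b \<in> mspace V" "c \<in> mspace V" using C(2) y by auto
      have nn: "0 \<le> mdist V y b" "0 \<le> mdist V y c" by simp_all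
      show "0 \<le> ?k b" "?k b \<le> 1" using \<delta> by auto
      show "\<bar>?k b - ?k c\<bar> \<le> mdist V b c"
        using triangle[OF y M] triangle[OF y M(2,1)] commute[of c b] by linarith
      show "mdist V b c \<le> ?k b + ?k c"
        using triangle[OF M(1) y M(2)] commute[of b y] dist_le_1[OF M] nn \<delta> by linarith
    qed
  qed (use C y in auto)
  then obtain y' where y': "y' \<in> mspace V" "\<And>c. c \<in> insert y C \<Longrightarrow> mdist V y' c = ?k c"
    by blast
  have "mdist V y' y \<le> \<delta>" using y'(2)[of y] y by simp
  moreover have "\<delta> \<le> mdist V y' c" if "c \<in> C" for c using y'(2)[of c] that \<delta>(2) by simp
  ultimately show ?thesis using y'(1) by blast
qed

text \<open>Coordinates are perturbed one after another, each time keeping clear of \<open>B\<close>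
  and of those already chosen. \<open>B\<close> may exceed \<open>A\<close> so that the tuple can
  avoid further points, as \<open>projection_transfer\<close> requires.\<close>

lemma perturb_tuple:
  assumes x: "x \<in> tuples n V" and B: "countable B" "A \<subseteq> B" "B \<subseteq> mspace V" and \<delta>: "0 < \<delta>" "\<delta> \<le> 1"
  obtains u where "u \<in> tuples n V" "separated \<delta> u"
    "\<And>i b. i < n \<Longrightarrow> b \<in> B \<Longrightarrow> \<delta> \<le> mdist V (u i) b"
    "\<And>i. i < n \<Longrightarrow> mdist V (u i) (x i) \<le> \<delta>"
proof -
  have "\<exists>u. (\<forall>i<m. u i \<in> mspace V \<and> mdist V (u i) (x i) \<le> \<delta> \<and> (\<forall>b\<in>B. \<delta> \<le> mdist V (u i) b))
      \<and> (\<forall>i<m. \<forall>j<i. \<delta> \<le> mdist V (u i) (u j))" if "m \<le> n" for m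
    using that
  proof (induction m)
    case 0
    show ?case by simp
  next
    case (Suc m)
    from Suc.IH[OF Suc_leD[OF Suc.prems]] obtain u
      where u0: "\<forall>i<m. u i \<in> mspace V \<and> mdist V (u i) (x i) \<le> \<delta> \<and> (\<forall>b\<in>B. \<delta> \<le> mdist V (u i) b)"
        "\<forall>i<m. \<forall>j<i. \<delta> \<le> mdist V (u i) (u j)"
      by (elim exE conjE)
    have u: "\<And>i. i < m \<Longrightarrow> u i \<in> mspace V" "\<And>i. i < m \<Longrightarrow> mdist V (u i) (x i) \<le> \<delta>"
        "\<And>i b. i < m \<Longrightarrow> b \<in> B \<Longrightarrow> \<delta> \<le> mdist V (u i) b"
        "\<And>i j. i < m \<Longrightarrow> j < i \<Longrightarrow> \<delta> \<le> mdist V (u i) (u j)"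
      using u0 by simp_all
    have C: "countable (B \<union> u ` {..<m})" "B \<union> u ` {..<m} \<subseteq> mspace V" using B u(1) by auto
    obtain y where y: "y \<in> mspace V" "mdist V y (x m) \<le> \<delta>"
        "\<And>c. c \<in> B \<union> u ` {..<m} \<Longrightarrow> \<delta> \<le> mdist V y c"
      using perturb_point[OF C tuple_mem[OF x, of m] \<delta>] Suc.prems by auto
    have "(u(m := y)) i \<in> mspace V \<and> mdist V ((u(m := y)) i) (x i) \<le> \<delta> \<and>
        (\<forall>b\<in>B. \<delta> \<le> mdist V ((u(m := y)) i) b)" if "i < Suc m" for i
      using that u y by (cases "i = m") auto
    moreover have "\<delta> \<le> mdist V ((u(m := y)) i) ((u(m := y)) j)" if "i < Suc m" "j < i" for i j
      using that u(4)[of i j] y(3) by (cases "i = m") auto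
    ultimately show ?case by (intro exI[of _ "u(m := y)"]) blast
  qed
  from this[OF order_refl] obtain u
    where u0: "\<forall>i<n. u i \<in> mspace V \<and> mdist V (u i) (x i) \<le> \<delta> \<and> (\<forall>b\<in>B. \<delta> \<le> mdist V (u i) b)"
      "\<forall>i<n. \<forall>j<i. \<delta> \<le> mdist V (u i) (u j)"
    by (elim exE conjE)
  have u: "\<And>i. i < n \<Longrightarrow> u i \<in> mspace V" "\<And>i. i < n \<Longrightarrow> mdist V (u i) (x i) \<le> \<delta>"
      "\<And>i b. i < n \<Longrightarrow> b \<in> B \<Longrightarrow> \<delta> \<le> mdist V (u i) b"
      "\<And>i j. i < n \<Longrightarrow> j < i \<Longrightarrow> \<delta> \<le> mdist V (u i) (u j)"
    using u0 by simp_all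
  have sym: "\<delta> \<le> mdist V (u i) (u j)" if "i < n" "j < n" "i \<noteq> j" for i j
  proof (cases "j < i")
    case True
    then show ?thesis using u(4)[OF that(1)] by blast
  next
    case False
    then have "i < j" using that(3) by linarith
    then show ?thesis using u(4)[OF that(2)] commute[of "u i" "u j"] by metis
  qed
  show thesis
  proof (rule that[of "restrict u {..<n}"])
    show "restrict u {..<n} \<in> tuples n V" using u(1) by (rule restrict_tuple)
    show "separated \<delta> (restrict u {..<n})"
      unfolding separated_def
    proof (intro conjI allI ballI impI)
      fix i assume i: "i < n"
      show "\<delta> \<le> mdist V (restrict u {..<n} i) a" if "a \<in> A" for a
        using u(3)[OF i subsetD[OF B(2) that]] i by simp
      show "\<delta> \<le> mdist V (restrict u {..<n} i) (restrict u {..<n} j)" if "j < n" "i \<noteq> j" for j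
        using sym[OF i that] i that(1) by simp
    qed
    show "\<delta> \<le> mdist V (restrict u {..<n} i) b" if "i < n" "b \<in> B" for i b
      using u(3)[OF that] that(1) by simp
    show "mdist V (restrict u {..<n} i) (x i) \<le> \<delta>" if "i < n" for i
      using u(2)[OF that] that by simp
  qed
qed

text \<open>Coordinates are exchanged one at a time by \<open>projection_move_one\<close>;
  \<open>cross\<close> keeps the mixed tuples separated.\<close>

lemma projection_move_all:
  assumes x: "x \<in> tuples n V" and u: "u \<in> tuples n V" and \<epsilon>: "\<epsilon> > 0"
    and sep: "separated \<epsilon> x" "separated \<epsilon> u"
    and cross: "\<And>i j. i < n \<Longrightarrow> j < n \<Longrightarrow> \<epsilon> \<le> mdist V (u i) (x j)"
    and j: "j < n" and gx: "g x = x j"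
  shows "g u = u j"
proof -
  define h where "h m = (\<lambda>i. if i < m then u i else x i)" for m
  have T: "h m \<in> tuples n V" for m
    using x u unfolding h_def PiE_iff extensional_def by auto
  have S: "separated \<epsilon> (h m)" for m
    unfolding separated_def
  proof (intro conjI allI ballI impI)
    fix i assume i: "i < n"
    show "\<epsilon> \<le> mdist V (h m i) a" if "a \<in> A" for a
      using sep that i by (simp add: h_def separated_def)
    show "\<epsilon> \<le> mdist V (h m i) (h m l)" if "l < n" "i \<noteq> l" for l
      using sep that i cross[of i l] cross[of l i] commute[of "x i" "u l"]
      by (simp add: h_def separated_def)
  qed
  have "g (h m) = h m j" if "m \<le> n" for m
    using that
  proof (induction m)
    case 0
    have "h 0 = x" by (simp add: h_def)
    then show ?case using gx by simp
  next
    case (Suc m)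
    have old: "h m = (h m)(m := x m)" and new: "h (Suc m) = (h m)(m := u m)"
      by (auto simp: h_def)
    have m: "m < n" using Suc.prems by simp
    have "g ((h m)(m := u m)) = ((h m)(m := u m)) j"
    proof (rule projection_move_one[OF T m tuple_mem[OF x m] tuple_mem[OF u m] \<epsilon> _ _ j])
      show "separated \<epsilon> ((h m)(m := x m))" using S[of m] old by simp
      show "separated \<epsilon> ((h m)(m := u m))" using S[of "Suc m"] new by simp
      show "g ((h m)(m := x m)) = ((h m)(m := x m)) j" using Suc old by simp
    qed
    then show ?case by (simp only: new)
  qed
  moreover have "h n = u"
    using PiE_arb[OF x] PiE_arb[OF u] by (intro ext) (auto simp: h_def)
  ultimately show ?thesis by (metis order_refl)
qed

text \<open>Exchanging the coordinates of \<open>x\<close> directly for those of \<open>x'\<close>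
  may fail, since mixed tuples can have coinciding entries. A tuple \<open>u\<close> clear of both
  serves as an intermediate station.\<close>

lemma projection_transfer:
  assumes x: "x \<in> tuples n V" "separated \<epsilon> x" "\<epsilon> > 0" and x': "x' \<in> tuples n V" "separated \<epsilon>' x'" "\<epsilon>' > 0"
    and j: "j < n" and gx: "g x = x j"
  shows "g x' = x' j"
proof -
  define \<delta> where "\<delta> = min 1 (min \<epsilon> \<epsilon>')"
  have \<delta>: "0 < \<delta>" "\<delta> \<le> 1" "\<delta> \<le> \<epsilon>" "\<delta> \<le> \<epsilon>'" using x(3) x'(3) by (auto simp: \<delta>_def)
  define B where "B = A \<union> x ` {..<n} \<union> x' ` {..<n}"
  have B: "countable B" "A \<subseteq> B" "B \<subseteq> mspace V"
    using countable_A A_sub tuple_mem[OF x(1)] tuple_mem[OF x'(1)] by (auto simp: B_def)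
  obtain u where u: "u \<in> tuples n V" "separated \<delta> u" "\<And>i b. i < n \<Longrightarrow> b \<in> B \<Longrightarrow> \<delta> \<le> mdist V (u i) b"
      "\<And>i. i < n \<Longrightarrow> mdist V (u i) (x i) \<le> \<delta>"
    by (rule perturb_tuple[OF x(1) B \<delta>(1,2)]) (rule that; blast)
  have Bx: "x l \<in> B" "x' l \<in> B" if "l < n" for l
    unfolding B_def using that by blast+
  have gu: "g u = u j"
  proof (rule projection_move_all[OF x(1) u(1) \<delta>(1) separated_mono[OF x(2) \<delta>(3)] u(2) _ j gx])
    show "\<delta> \<le> mdist V (u i) (x l)" if "i < n" "l < n" for i l
      using that(1) Bx(1)[OF that(2)] by (rule u(3))
  qed
  show ?thesis
  proof (rule projection_move_all[OF u(1) x'(1) \<delta>(1) u(2) separated_mono[OF x'(2) \<delta>(4)] _ j gu])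
    show "\<delta> \<le> mdist V (x' i) (u l)" if "i < n" "l < n" for i l
      using u(3)[OF that(2) Bx(2)[OF that(1)]] commute[of "u l" "x' i"] by simp
  qed
qed

lemma separated_approximation:
  assumes x: "x \<in> tuples n V"
  shows "\<exists>u. (\<forall>m. u m \<in> tuples n V \<and> separated (inverse (real (Suc m))) (u m)) \<and>
    (\<forall>i<n. (\<lambda>m. mdist V (u m i) (x i)) \<longlonglongrightarrow> 0)"
proof -
  have "\<exists>u. u \<in> tuples n V \<and> separated (inverse (real (Suc m))) u \<and>
      (\<forall>i<n. mdist V (u i) (x i) \<le> inverse (real (Suc m)))" for m
  proof -
    have \<delta>: "0 < inverse (real (Suc m))" "inverse (real (Suc m)) \<le> 1" by (simp_all add: field_simps)
    show ?thesis
    proof (rule perturb_tuple[OF x countable_A order_refl A_sub \<delta>])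
      fix u assume "u \<in> tuples n V" "separated (inverse (real (Suc m))) u"
        "\<And>i. i < n \<Longrightarrow> mdist V (u i) (x i) \<le> inverse (real (Suc m))"
      then show ?thesis by blast
    qed
  qed
  then obtain u where u: "\<And>m. u m \<in> tuples n V" "\<And>m. separated (inverse (real (Suc m))) (u m)"
      "\<And>m i. i < n \<Longrightarrow> mdist V (u m i) (x i) \<le> inverse (real (Suc m))" by metis
  have "(\<lambda>m. mdist V (u m i) (x i)) \<longlonglongrightarrow> 0" if "i < n" for i
    by (rule tendsto_sandwich[OF _ _ tendsto_const LIMSEQ_inverse_real_of_nat])
      (intro always_eventually allI nonneg u(3)[OF that])+
  then show ?thesis using u(1,2) by (intro exI[of _ u]) simp
qed

text \<open>The split is on a single separated tuple whose value is one of its coordinates: by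
  \<open>projection_transfer\<close> it fixes the index for all separated tuples, and approximation
  with \<open>g_continuous\<close> reaches the others.\<close>

lemma projection_or_near:
  "(\<exists>i<n. \<forall>x\<in>tuples n V. g x = x i) \<or> (\<forall>x\<in>tuples n V. near_A (g x))"
proof (cases "\<exists>x\<in>tuples n V. \<exists>\<epsilon>>0. separated \<epsilon> x \<and> (\<exists>j<n. g x = x j)")
  case True
  then obtain z \<epsilon> j where z: "z \<in> tuples n V" "\<epsilon> > 0" "separated \<epsilon> z" "j < n" "g z = z j" by blast
  have "g x = x j" if x: "x \<in> tuples n V" for x
  proof -
    from separated_approximation[OF x] obtain u
      where u0: "\<forall>m. u m \<in> tuples n V \<and> separated (inverse (real (Suc m))) (u m)"
        "\<forall>i<n. (\<lambda>m. mdist V (u m i) (x i)) \<longlonglongrightarrow> 0"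
      by (elim exE conjE)
    then have u: "\<And>m. u m \<in> tuples n V" "\<And>m. separated (inverse (real (Suc m))) (u m)"
        "\<And>i. i < n \<Longrightarrow> (\<lambda>m. mdist V (u m i) (x i)) \<longlonglongrightarrow> 0"
      by simp_all
    have gu: "g (u m) = u m j" for m
      by (rule projection_transfer[OF z(1,3,2) u(1,2) _ z(4,5)]) simp
    have "(\<lambda>m. mdist V (g (u m)) (u m j)) \<longlonglongrightarrow> mdist V (g x) (x j)"
      by (intro dist_tendsto g_mem u x tuple_mem[OF u(1) z(4)] tuple_mem[OF x z(4)] g_continuous z(4))
    moreover have "mdist V (g (u m)) (u m j) = 0" for m
      using gu[of m] tuple_mem[OF u(1) z(4)] by simp
    ultimately have "mdist V (g x) (x j) = 0" by (simp add: LIMSEQ_const_iff)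
    then show ?thesis using g_mem[OF x] tuple_mem[OF x z(4)] by simp
  qed
  then show ?thesis using z(4) by blast
next
  case False
  have "near_A (g x)" if x: "x \<in> tuples n V" for x
    unfolding near_A_def
  proof (intro allI impI)
    fix \<epsilon> :: real assume \<epsilon>: "\<epsilon> > 0"
    from separated_approximation[OF x] obtain u
      where u0: "\<forall>m. u m \<in> tuples n V \<and> separated (inverse (real (Suc m))) (u m)"
        "\<forall>i<n. (\<lambda>m. mdist V (u m i) (x i)) \<longlonglongrightarrow> 0"
      by (elim exE conjE)
    then have u: "\<And>m. u m \<in> tuples n V" "\<And>m. separated (inverse (real (Suc m))) (u m)"
        "\<And>i. i < n \<Longrightarrow> (\<lambda>m. mdist V (u m i) (x i)) \<longlonglongrightarrow> 0"
      by simp_all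
    have "(\<lambda>m. mdist V (g (u m)) (g x)) \<longlonglongrightarrow> 0"
      by (rule g_continuous[OF u(1) x u(3)])
    then have "\<forall>\<^sub>F m in sequentially. mdist V (g (u m)) (g x) < \<epsilon> / 2"
      using \<epsilon> by (intro order_tendstoD(2)[where y = 0]) auto
    then obtain m where m: "mdist V (g (u m)) (g x) < \<epsilon> / 2"
      by (auto simp: eventually_sequentially)
    have "inverse (real (Suc m)) > 0" by simp
    then have "near_A (g (u m))" using value_cases[OF u(1)] False u(1,2) by blast
    then obtain a where a: "a \<in> A" "mdist V (g (u m)) a < \<epsilon> / 2"
      using \<epsilon> unfolding near_A_def by (meson half_gt_zero)
    have "mdist V (g x) a \<le> mdist V (g x) (g (u m)) + mdist V (g (u m)) a"
      using a(1) A_sub by (intro triangle g_mem u(1) x) blast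
    then have "mdist V (g x) a < \<epsilon>" using m a(2) commute[of "g x" "g (u m)"] by simp
    then show "\<exists>a\<in>A. mdist V (g x) a < \<epsilon>" using a(1) by blast
  qed
  then show ?thesis by blast
qed

section \<open>Compactness of the range\<close>

text \<open>The arguments of the given values need not have a convergent subsequence. Only the
  distances of the values to \<open>A\<close> are made to converge, and \<open>graph_limit\<close>
  supplies a fresh argument for the limit value.\<close>

lemma range_compact:
  assumes near: "\<And>x. x \<in> tuples n V \<Longrightarrow> near_A (g x)"
  shows "compactin mtopology (g ` tuples n V)"
  unfolding compactin_sequentially
proof (intro conjI allI impI)
  show "g ` tuples n V \<subseteq> mspace V" by (intro image_subsetI g_mem)
  fix \<sigma> :: "nat \<Rightarrow> 'a" assume "range \<sigma> \<subseteq> g ` tuples n V"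
  then have "\<forall>m. \<exists>x. x \<in> tuples n V \<and> \<sigma> m = g x" by blast
  then obtain z where z: "\<And>m. z m \<in> tuples n V" "\<And>m. \<sigma> m = g (z m)" by metis
  have "near_A (g (z 0))" by (rule near[OF z(1)])
  then have "A \<noteq> {}" unfolding near_A_def by (metis empty_iff zero_less_one)
  define q where "q = from_nat_into A"
  have q: "q i \<in> mspace V" for i
    using from_nat_into[OF \<open>A \<noteq> {}\<close>] A_sub by (auto simp: q_def)
  have "mdist V (\<sigma> m) (q i) \<in> {0..1}" for m i
    using dist_le_1[OF g_mem[OF z(1)] q] by (simp add: z(2))
  then obtain r where r: "strict_mono r" "\<And>i. convergent (\<lambda>m. mdist V (\<sigma> (r m)) (q i))"
    using diagonal_convergent_subsequence[of "\<lambda>m i. mdist V (\<sigma> m) (q i)"] by auto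
  have conv: "convergent (\<lambda>m. mdist V (\<sigma> (r m)) a)" if "a \<in> A" for a
    using r(2) from_nat_into_surj[OF countable_A that] unfolding q_def by metis
  define e where "e m = (\<lambda>v\<in>{..<Suc n}. ((z (r m))(n := \<sigma> (r m))) v)" for m
  have e_part: "restrict (e m) {..<n} = z (r m)" "e m n = \<sigma> (r m)" for m
    using PiE_arb[OF z(1)[of "r m"]] by (auto simp: e_def fun_eq_iff)
  define T :: "('a trm \<times> 'a trm) set" where "T = (\<lambda>a. (Var n, Param a)) ` A"
  have "\<exists>e'\<in>tuples (Suc n) V. e' n = g (restrict e' {..<n}) \<and> (\<forall>(s, t)\<in>T.
      mdist V (trm_val s e') (trm_val t e') = lim (\<lambda>m. mdist V (trm_val s (e m)) (trm_val t (e m))))"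
  proof (rule graph_limit[OF _ countable_A order_refl A_sub])
    show "e m \<in> tuples (Suc n) V" for m
      unfolding e_def
      by (intro restrict_tuple) (use tuple_mem[OF z(1)] g_mem[OF z(1)] z(2) in \<open>auto simp: less_Suc_eq\<close>)
    show "e m n = g (restrict (e m) {..<n})" for m unfolding e_part by (rule z(2))
    show "T \<subseteq> terms A {..<Suc n} \<times> terms A {..<Suc n}" by (auto simp: T_def terms_def)
    fix s t assume "(s, t) \<in> T"
    then obtain a where "a \<in> A" "s = Var n" "t = Param a" by (auto simp: T_def)
    then show "(\<lambda>m. mdist V (trm_val s (e m)) (trm_val t (e m)))
        \<longlonglongrightarrow> lim (\<lambda>m. mdist V (trm_val s (e m)) (trm_val t (e m)))"
      using conv[of a] by (simp add: e_part convergent_LIMSEQ_iff)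
  qed simp
  then obtain e' where e': "e' \<in> tuples (Suc n) V" "e' n = g (restrict e' {..<n})"
      "\<And>a. a \<in> A \<Longrightarrow> mdist V (e' n) a = lim (\<lambda>m. mdist V (\<sigma> (r m)) a)"
    by (auto simp: T_def e_part)
  define y where "y = e' n"
  have x: "restrict e' {..<n} \<in> tuples n V"
    using tuple_mem[OF e'(1)] by (intro restrict_tuple) simp
  have y: "y \<in> mspace V" "y \<in> g ` tuples n V" "near_A y"
    using near[OF x] g_mem[OF x] x e'(2) by (auto simp: y_def)
  have lim: "(\<lambda>m. mdist V (\<sigma> (r m)) a) \<longlonglongrightarrow> mdist V y a" if "a \<in> A" for a
    using conv[OF that] e'(3)[OF that] by (simp add: y_def convergent_LIMSEQ_iff)
  have \<sigma>: "\<sigma> m \<in> mspace V" for m unfolding z(2) by (rule g_mem[OF z(1)])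
  \<comment> \<open>Distances to \<open>A\<close> locate the limit because \<open>y\<close> is
    itself in the closure of \<open>A\<close>: a point of \<open>A\<close> close to \<open>y\<close>
    is close to all late values too.\<close>
  have "(\<lambda>m. mdist V (\<sigma> (r m)) y) \<longlonglongrightarrow> 0"
  proof (rule tendstoI)
    fix \<epsilon> :: real assume "\<epsilon> > 0"
    then obtain a where a: "a \<in> A" "mdist V y a < \<epsilon> / 2"
      using y(3) unfolding near_A_def by (meson half_gt_zero)
    have aV: "a \<in> mspace V" using a(1) A_sub by blast
    have "\<forall>\<^sub>F m in sequentially. mdist V (\<sigma> (r m)) a < \<epsilon> / 2"
      using order_tendstoD(2)[OF lim[OF a(1)] a(2)] .
    then show "\<forall>\<^sub>F m in sequentially. dist (mdist V (\<sigma> (r m)) y) 0 < \<epsilon>"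
    proof eventually_elim
      case (elim m)
      then show ?case
        using triangle[OF \<sigma> aV y(1), of "r m"] a(2) commute[of a y] by simp
    qed
  qed
  then have "limitin mtopology (\<sigma> \<circ> r) y sequentially"
    unfolding limitin_metric_dist_null using y(1) \<sigma> by (simp add: o_def)
  then show "\<exists>l r. l \<in> g ` tuples n V \<and> strict_mono r \<and> limitin mtopology (\<sigma> \<circ> r) l sequentially"
    using y(2) r(1) by blast
qed

lemma near_A_closure: "y \<in> mspace V \<Longrightarrow> near_A y \<Longrightarrow> y \<in> mtopology closure_of A"
  unfolding metric_closure_of near_A_def using A_sub by (fastforce simp: in_mball)

lemma range_or_projection:
  "(compactin mtopology (g ` tuples n V) \<and> g ` tuples n V \<subseteq> mtopology closure_of A)
    \<or> (\<exists>i<n. \<forall>x\<in>tuples n V. g x = x i)"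
  using projection_or_near
proof
  assume "\<forall>x\<in>tuples n V. near_A (g x)"
  then have near: "\<And>x. x \<in> tuples n V \<Longrightarrow> near_A (g x)" by blast
  then have "g ` tuples n V \<subseteq> mtopology closure_of A"
    by (intro image_subsetI near_A_closure g_mem)
  then show ?thesis using range_compact[OF near] by blast
qed blast

end

theorem theorem2p4:
  fixes U V :: "'a metric" and A :: "'a set" and n :: nat
    and f g :: "(nat \<Rightarrow> 'a) \<Rightarrow> 'a"
  assumes "urysohn_sphere U"
    and "metric_structure V" and "elementary_extension U V" and "omega1_saturated V"
    and "countable A" and "A \<subseteq> mspace U"
    and "n \<ge> 1"
    and "definable_function U A n f"
    and "natural_extension U V A n f g"
  shows "(compactin (mtopology_of V) (g ` tuples n V) \<and>
          g ` tuples n V \<subseteq> mtopology_of V closure_of A)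
       \<or> (\<exists>i<n. \<forall>x\<in>tuples n V. g x = x i)"
proof -
  obtain \<phi> P where g: "g \<in> tuples n V \<rightarrow> mspace V" and \<phi>: "defines_function U A n \<phi> f"
    and lim: "uniform_limit (tuples n V \<times> mspace V)
      (\<lambda>k (x, y). val V (\<phi> k) (x(n := y))) P sequentially"
    and zero: "\<forall>x\<in>tuples n V. \<forall>y\<in>mspace V. P (x, y) = 0 \<longleftrightarrow> y = g x"
    using assms(9) unfolding natural_extension_def by blast
  interpret definable_graph U V A n g \<phi> P
  proof
    show "A \<subseteq> mspace V" using assms(3,6) by (auto simp: elementary_extension_def)
    show "\<phi> k \<in> formulas A {..n}" for k using \<phi> by (simp add: defines_function_def)
    show "P (x, y) = 0 \<longleftrightarrow> y = g x" if "x \<in> tuples n V" "y \<in> mspace V" for x y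
      using zero that by blast
  qed fact+
  show ?thesis unfolding mtopology_of_def by (rule range_or_projection)
qed

end
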